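(* Let $\rho\in\mathbb R$, let $\mathbf a=\{a_n\}_{n\ge1}$ be an admissible sequence of non-negative real numbers, and let $\kappa_{\mathbf a}(s,u)=\sum_{n\ge1}a_nn^{-s-\bar u}$ be the diagonal Dirichlet series kernel on $\mathbb H_\rho\times\mathbb H_\rho$ associated with $\mathbf a$, with reproducing kernel Hilbert space $\mathscr H_{\mathbf a}$; write $\kappa_{\mathbf a,u}=\kappa_{\mathbf a}(\cdot,u)$. For every real $\alpha>\rho$, let $T_\alpha$ be the linear operator in $\mathscr H_{\mathbf a}$ with domain $\mathcal D(T_\alpha)=\mathrm{span}\{\kappa_{\mathbf a,\alpha+ib}:b\in\mathbb R\}$ defined by $T_\alpha\kappa_{\mathbf a,\alpha+ib}=ib\,\kappa_{\mathbf a,\alpha+ib}$, $b\in\mathbb R$, extended linearly. Then (i) $T_\alpha$ is a $\mathscr T$-homogeneous operator in $\mathscr H_{\mathbf a}$; (ii) the domain $\mathcal D(T_\alpha^* )$ of the Hilbert space adjoint of $T_\alpha$ is $\{0\}$. Consequently $T_\alpha$ is not closable.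
   Context: $\mathbb H_\rho=\{\Re s>\rho\}$. The diagonal Dirichlet series kernel associated with $\mathbf a$ is $\kappa_{\mathbf a}(s,u)=\sum_n a_nn^{-s-\bar u}$, assumed convergent on $\mathbb H_\rho\times\mathbb H_\rho$ (it is positive semi-definite); $\mathscr H_{\mathbf a}$ is the Hilbert space of functions on $\mathbb H_\rho$ with $\kappa_{\mathbf a}(\cdot,t)\in\mathscr H_{\mathbf a}$ and $\langle f,\kappa_{\mathbf a}(\cdot,t)\rangle=f(t)$. A sequence $\mathbf a$ of real numbers is admissible if its support $\mathrm{supp}(\mathbf a)=\{n:a_n\ne0\}$ is an infinite subset of $\mathbb N$ closed under multiplication and there exist $p,q\in\mathrm{supp}(\mathbf a)\setminus\{1\}$ with $\gcd(p,q)=1$. A densely defined linear operator $T$ with domain $\mathcal D(T)$ in a complex Hilbert space $\mathcal H$ is $\mathscr T$-homogeneous if for every $c\in\mathbb R$ there is a unitary $U_c$ on $\mathcal H$ with $U_c\mathcal D(T)\subseteq\mathcal D(T)$ and $U_cTf=(T-icI)U_cf$ for all $f\in\mathcal D(T)$. *)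

theory Defs
  imports "HOL-Analysis.Analysis"
begin

text \<open>Sequences are indexed by nat; only indices n >= 1 matter (the term for n = 0
vanishes since 0 powr z = 0).\<close>

definition seq_supp :: "(nat \<Rightarrow> real) \<Rightarrow> nat set" where
  "seq_supp a = {n. 1 \<le> n \<and> a n \<noteq> 0}"

definition admissible :: "(nat \<Rightarrow> real) \<Rightarrow> bool" where
  "admissible a \<longleftrightarrow>
     infinite (seq_supp a) \<and>
     (\<forall>m\<in>seq_supp a. \<forall>n\<in>seq_supp a. m * n \<in> seq_supp a) \<and>
     (\<exists>p\<in>seq_supp a - {1}. \<exists>q\<in>seq_supp a - {1}. coprime p q)"

definition dkernel :: "(nat \<Rightarrow> real) \<Rightarrow> complex \<Rightarrow> complex \<Rightarrow> complex" where
  "dkernel a s u = (\<Sum>n. complex_of_real (a n) * of_nat n powr (- (s + cnj u)))"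

definition kfun :: "real \<Rightarrow> (nat \<Rightarrow> real) \<Rightarrow> complex \<Rightarrow> complex \<Rightarrow> complex" where
  "kfun \<rho> a u = (\<lambda>s. if \<rho> < Re s then dkernel a s u else 0)"

definition hnorm :: "((complex \<Rightarrow> complex) \<Rightarrow> (complex \<Rightarrow> complex) \<Rightarrow> complex)
    \<Rightarrow> (complex \<Rightarrow> complex) \<Rightarrow> real" where
  "hnorm ip f = sqrt (Re (ip f f))"

definition is_function_hilbert_space ::
  "(complex \<Rightarrow> complex) set \<Rightarrow> ((complex \<Rightarrow> complex) \<Rightarrow> (complex \<Rightarrow> complex) \<Rightarrow> complex) \<Rightarrow> bool" where
  "is_function_hilbert_space H ip \<longleftrightarrow>
     (\<lambda>s. 0) \<in> H \<and>
     (\<forall>f\<in>H. \<forall>g\<in>H. (\<lambda>s. f s + g s) \<in> H) \<and>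
     (\<forall>f\<in>H. \<forall>c. (\<lambda>s. c * f s) \<in> H) \<and>
     (\<forall>f\<in>H. \<forall>g\<in>H. \<forall>h\<in>H. \<forall>c. ip (\<lambda>s. c * f s + g s) h = c * ip f h + ip g h) \<and>
     (\<forall>f\<in>H. \<forall>g\<in>H. ip g f = cnj (ip f g)) \<and>
     (\<forall>f\<in>H. Im (ip f f) = 0 \<and> 0 \<le> Re (ip f f)) \<and>
     (\<forall>f\<in>H. ip f f = 0 \<longrightarrow> f = (\<lambda>s. 0)) \<and>
     (\<forall>x. (\<forall>n. x n \<in> H) \<longrightarrow>
        (\<forall>e>0. \<exists>N. \<forall>m\<ge>N. \<forall>n\<ge>N. hnorm ip (\<lambda>s. x m s - x n s) < e) \<longrightarrow>
        (\<exists>f\<in>H. (\<lambda>n. hnorm ip (\<lambda>s. x n s - f s)) \<longlonglongrightarrow> 0))"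

text \<open>(H, ip) is the reproducing kernel Hilbert space of functions on
{Re s > rho} (functions extended by 0 outside) with kernel K.\<close>

definition is_rkhs :: "real \<Rightarrow> (complex \<Rightarrow> complex \<Rightarrow> complex) \<Rightarrow> (complex \<Rightarrow> complex) set
    \<Rightarrow> ((complex \<Rightarrow> complex) \<Rightarrow> (complex \<Rightarrow> complex) \<Rightarrow> complex) \<Rightarrow> bool" where
  "is_rkhs \<rho> K H ip \<longleftrightarrow>
     is_function_hilbert_space H ip \<and>
     (\<forall>f\<in>H. \<forall>s. Re s \<le> \<rho> \<longrightarrow> f s = 0) \<and>
     (\<forall>t. \<rho> < Re t \<longrightarrow> (\<lambda>s. if \<rho> < Re s then K s t else 0) \<in> H) \<and>
     (\<forall>f\<in>H. \<forall>t. \<rho> < Re t \<longrightarrow> ip f (\<lambda>s. if \<rho> < Re s then K s t else 0) = f t)"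

definition cspan :: "(complex \<Rightarrow> complex) set \<Rightarrow> (complex \<Rightarrow> complex) set" where
  "cspan S = {f. \<exists>F c. finite F \<and> F \<subseteq> S \<and> f = (\<lambda>s. \<Sum>g\<in>F. c g * g s)}"

definition dense_in :: "(complex \<Rightarrow> complex) set \<Rightarrow> ((complex \<Rightarrow> complex) \<Rightarrow> (complex \<Rightarrow> complex) \<Rightarrow> complex)
    \<Rightarrow> (complex \<Rightarrow> complex) set \<Rightarrow> bool" where
  "dense_in H ip D \<longleftrightarrow> D \<subseteq> H \<and>
     (\<forall>f\<in>H. \<forall>e>0. \<exists>g\<in>D. hnorm ip (\<lambda>s. f s - g s) < e)"

text \<open>T is a linear operator in H with domain D (a linear subspace of H); values of T
outside D are irrelevant.\<close>

definition linear_op_on :: "(complex \<Rightarrow> complex) set \<Rightarrow> (complex \<Rightarrow> complex) set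
    \<Rightarrow> ((complex \<Rightarrow> complex) \<Rightarrow> (complex \<Rightarrow> complex)) \<Rightarrow> bool" where
  "linear_op_on H D T \<longleftrightarrow> D \<subseteq> H \<and> (\<lambda>s. 0) \<in> D \<and>
     (\<forall>f\<in>D. \<forall>g\<in>D. (\<lambda>s. f s + g s) \<in> D) \<and>
     (\<forall>f\<in>D. \<forall>c. (\<lambda>s. c * f s) \<in> D) \<and>
     (\<forall>f\<in>D. T f \<in> H) \<and>
     (\<forall>f\<in>D. \<forall>g\<in>D. T (\<lambda>s. f s + g s) = (\<lambda>s. T f s + T g s)) \<and>
     (\<forall>f\<in>D. \<forall>c. T (\<lambda>s. c * f s) = (\<lambda>s. c * T f s))"

definition unitary_on :: "(complex \<Rightarrow> complex) set \<Rightarrow> ((complex \<Rightarrow> complex) \<Rightarrow> (complex \<Rightarrow> complex) \<Rightarrow> complex)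
    \<Rightarrow> ((complex \<Rightarrow> complex) \<Rightarrow> (complex \<Rightarrow> complex)) \<Rightarrow> bool" where
  "unitary_on H ip U \<longleftrightarrow> U ` H = H \<and> (\<forall>f\<in>H. \<forall>g\<in>H. ip (U f) (U g) = ip f g)"

definition T_homogeneous :: "(complex \<Rightarrow> complex) set \<Rightarrow> ((complex \<Rightarrow> complex) \<Rightarrow> (complex \<Rightarrow> complex) \<Rightarrow> complex)
    \<Rightarrow> (complex \<Rightarrow> complex) set \<Rightarrow> ((complex \<Rightarrow> complex) \<Rightarrow> (complex \<Rightarrow> complex)) \<Rightarrow> bool" where
  "T_homogeneous H ip D T \<longleftrightarrow>
     linear_op_on H D T \<and> dense_in H ip D \<and>
     (\<forall>c::real. \<exists>U. unitary_on H ip U \<and> U ` D \<subseteq> D \<and>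
        (\<forall>f\<in>D. U (T f) = (\<lambda>s. T (U f) s - \<i> * of_real c * U f s)))"

definition adjoint_domain :: "(complex \<Rightarrow> complex) set \<Rightarrow> ((complex \<Rightarrow> complex) \<Rightarrow> (complex \<Rightarrow> complex) \<Rightarrow> complex)
    \<Rightarrow> (complex \<Rightarrow> complex) set \<Rightarrow> ((complex \<Rightarrow> complex) \<Rightarrow> (complex \<Rightarrow> complex)) \<Rightarrow> (complex \<Rightarrow> complex) set" where
  "adjoint_domain H ip D T = {g\<in>H. \<exists>h\<in>H. \<forall>f\<in>D. ip (T f) g = ip f h}"

definition closable :: "(complex \<Rightarrow> complex) set \<Rightarrow> ((complex \<Rightarrow> complex) \<Rightarrow> (complex \<Rightarrow> complex) \<Rightarrow> complex)
    \<Rightarrow> (complex \<Rightarrow> complex) set \<Rightarrow> ((complex \<Rightarrow> complex) \<Rightarrow> (complex \<Rightarrow> complex)) \<Rightarrow> bool" where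
  "closable H ip D T \<longleftrightarrow>
     (\<forall>x y. (\<forall>n. x n \<in> D) \<longrightarrow> y \<in> H \<longrightarrow>
        (\<lambda>n. hnorm ip (x n)) \<longlonglongrightarrow> 0 \<longrightarrow>
        (\<lambda>n. hnorm ip (\<lambda>s. T (x n) s - y s)) \<longlonglongrightarrow> 0 \<longrightarrow> y = (\<lambda>s. 0))"

end

theory Submission
  imports Defs "HOL-Library.Function_Algebras"
begin

text \<open>Under \<open>\<kappa>\<^bsub>u\<^esub> \<mapsto> (n powr (- cnj u))\<^bsub>n\<^esub>\<close> the span of the kernels is isometric to a subspace of
  the \<open>l\<^sup>2\<close>-space with weights \<open>a n\<close>, and moving \<open>u\<close> vertically by \<open>c\<close> multiplies the \<open>n\<close>-th
  entry by the character \<open>cis (c * ln n)\<close>. Everything about \<open>T\<close> comes from these characters.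

  Averaging over an arithmetic progression of characters that separates the integers isolates a
  single entry, so the kernels on a vertical line span a dense subspace. Vertical translation is
  isometric on this subspace, hence unitary on \<open>H\<close>, and it shifts the eigenvalues of \<open>T\<close>. Two coprime
  integers in the support separate the characters, so the kernels on the line are independent
  and \<open>T\<close> is well defined.

  Finally there are times \<open>\<tau> \<rightarrow> \<infinity>\<close> along which all characters return to \<open>1\<close>. Along them
  \<open>x = (\<kappa>\<^bsub>\<alpha> + i(b + \<tau>)\<^esub> - \<kappa>\<^bsub>\<alpha> + ib\<^esub>) / (i \<tau>)\<close> tends to \<open>0\<close> whereas \<open>T x\<close> tends to \<open>\<kappa>\<^bsub>\<alpha> + ib\<^esub>\<close>.
  So \<open>T\<close> is not closable, and every element of the domain of its adjoint vanishes on the line.\<close>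

subsection \<open>Hilbert spaces of functions\<close>

text \<open>The space is a carrier set with an explicit inner product, so the elementary Hilbert
  space theory is derived here from its axioms.\<close>

locale function_hilbert =
  fixes H :: "(complex \<Rightarrow> complex) set"
    and ip :: "(complex \<Rightarrow> complex) \<Rightarrow> (complex \<Rightarrow> complex) \<Rightarrow> complex"
  assumes hilbert: "is_function_hilbert_space H ip"
begin

lemma zero_mem [simp]: "(\<lambda>s. 0) \<in> H"
  and add_mem [simp]: "f \<in> H \<Longrightarrow> g \<in> H \<Longrightarrow> (\<lambda>s. f s + g s) \<in> H"
  and scale_mem [simp]: "f \<in> H \<Longrightarrow> (\<lambda>s. c * f s) \<in> H"
  and ip_linear: "f \<in> H \<Longrightarrow> g \<in> H \<Longrightarrow> h \<in> H \<Longrightarrow> ip (\<lambda>s. c * f s + g s) h = c * ip f h + ip g h"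
  and ip_commute: "f \<in> H \<Longrightarrow> g \<in> H \<Longrightarrow> ip g f = cnj (ip f g)"
  and ip_self_Im: "f \<in> H \<Longrightarrow> Im (ip f f) = 0"
  and ip_self_ge_0: "f \<in> H \<Longrightarrow> 0 \<le> Re (ip f f)"
  and ip_self_eq_0D: "f \<in> H \<Longrightarrow> ip f f = 0 \<Longrightarrow> f = (\<lambda>s. 0)"
  using hilbert unfolding is_function_hilbert_space_def by blast+

lemma complete:
  assumes "\<And>n::nat. x n \<in> H"
    and "\<And>e. 0 < e \<Longrightarrow> \<exists>N. \<forall>m\<ge>N. \<forall>n\<ge>N. hnorm ip (\<lambda>s. x m s - x n s) < e"
  obtains f where "f \<in> H" "(\<lambda>n. hnorm ip (\<lambda>s. x n s - f s)) \<longlonglongrightarrow> 0"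
proof -
  have "\<forall>x. (\<forall>n. x n \<in> H) \<longrightarrow>
      (\<forall>e>0. \<exists>N. \<forall>m\<ge>N. \<forall>n\<ge>N. hnorm ip (\<lambda>s. x m s - x n s) < e) \<longrightarrow>
      (\<exists>f\<in>H. (\<lambda>n. hnorm ip (\<lambda>s. x n s - f s)) \<longlonglongrightarrow> 0)"
    using hilbert unfolding is_function_hilbert_space_def by (elim conjE)
  from this[rule_format, of x] assms that show ?thesis by blast
qed

lemma diff_mem [simp]: "f \<in> H \<Longrightarrow> g \<in> H \<Longrightarrow> (\<lambda>s. f s - g s) \<in> H"
  using add_mem[OF _ scale_mem[of g "-1"], of f] by simp

lemma sum_mem:
  assumes "\<And>i. i \<in> I \<Longrightarrow> f i \<in> H"
  shows "(\<lambda>s. \<Sum>i\<in>I. c i * f i s) \<in> H"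
  using assms by (induction I rule: infinite_finite_induct) auto

lemma ip_zero_left [simp]: "h \<in> H \<Longrightarrow> ip (\<lambda>s. 0) h = 0"
  using ip_linear[of "\<lambda>s. 0" "\<lambda>s. 0" h 1] by simp

lemma ip_zero_right [simp]: "h \<in> H \<Longrightarrow> ip h (\<lambda>s. 0) = 0"
  using ip_commute[of "\<lambda>s. 0" h] by simp

lemma hnorm_zero [simp]: "hnorm ip (\<lambda>s. 0) = 0"
  by (simp add: hnorm_def)

lemma ip_add_left: "f \<in> H \<Longrightarrow> g \<in> H \<Longrightarrow> h \<in> H \<Longrightarrow> ip (\<lambda>s. f s + g s) h = ip f h + ip g h"
  using ip_linear[of f g h 1] by simp

lemma ip_scale_left: "f \<in> H \<Longrightarrow> h \<in> H \<Longrightarrow> ip (\<lambda>s. c * f s) h = c * ip f h"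
  using ip_linear[of f "\<lambda>s. 0" h c] by simp

lemma ip_diff_left: "f \<in> H \<Longrightarrow> g \<in> H \<Longrightarrow> h \<in> H \<Longrightarrow> ip (\<lambda>s. f s - g s) h = ip f h - ip g h"
  using ip_linear[of g f h "-1"] by simp

lemma ip_sum_left:
  assumes "\<And>i. i \<in> I \<Longrightarrow> f i \<in> H" "h \<in> H"
  shows "ip (\<lambda>s. \<Sum>i\<in>I. c i * f i s) h = (\<Sum>i\<in>I. c i * ip (f i) h)"
  using assms
  by (induction I rule: infinite_finite_induct) (auto simp: ip_linear sum_mem)

lemma ip_add_right: "f \<in> H \<Longrightarrow> g \<in> H \<Longrightarrow> h \<in> H \<Longrightarrow> ip h (\<lambda>s. f s + g s) = ip h f + ip h g"
  by (simp add: ip_add_left ip_commute[of _ h])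

lemma ip_scale_right: "f \<in> H \<Longrightarrow> h \<in> H \<Longrightarrow> ip h (\<lambda>s. c * f s) = cnj c * ip h f"
  by (simp add: ip_scale_left ip_commute[of _ h])

lemma ip_diff_right: "f \<in> H \<Longrightarrow> g \<in> H \<Longrightarrow> h \<in> H \<Longrightarrow> ip h (\<lambda>s. f s - g s) = ip h f - ip h g"
  by (simp add: ip_diff_left ip_commute[of _ h])

lemma ip_sum_right:
  assumes "\<And>i. i \<in> I \<Longrightarrow> f i \<in> H" "h \<in> H"
  shows "ip h (\<lambda>s. \<Sum>i\<in>I. c i * f i s) = (\<Sum>i\<in>I. cnj (c i) * ip h (f i))"
proof -
  have "ip h (\<lambda>s. \<Sum>i\<in>I. c i * f i s) = cnj (\<Sum>i\<in>I. c i * ip (f i) h)"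
    using assms by (simp add: ip_sum_left sum_mem ip_commute[of "\<lambda>s. \<Sum>i\<in>I. c i * f i s" h])
  also have "\<dots> = (\<Sum>i\<in>I. cnj (c i) * ip h (f i))"
    using assms by (auto intro!: sum.cong simp: ip_commute[of _ h])
  finally show ?thesis .
qed

section \<open>Norms: Cauchy-Schwarz, triangle inequality, continuity, polarization\<close>

lemma ip_self: "f \<in> H \<Longrightarrow> ip f f = of_real ((hnorm ip f)\<^sup>2)"
  by (simp add: complex_eq_iff hnorm_def ip_self_Im ip_self_ge_0)

lemma hnorm_sq: "f \<in> H \<Longrightarrow> (hnorm ip f)\<^sup>2 = Re (ip f f)"
  by (simp add: hnorm_def ip_self_ge_0)

lemma hnorm_ge_0 [simp]: "f \<in> H \<Longrightarrow> 0 \<le> hnorm ip f"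
  by (simp add: hnorm_def ip_self_ge_0)

lemma hnorm_eq_0_iff: "f \<in> H \<Longrightarrow> hnorm ip f = 0 \<longleftrightarrow> f = (\<lambda>s. 0)"
  using ip_self_eq_0D[of f] ip_self[of f] by auto

lemma hnorm_scale:
  assumes "f \<in> H" shows "hnorm ip (\<lambda>s. c * f s) = cmod c * hnorm ip f"
proof -
  have "ip (\<lambda>s. c * f s) (\<lambda>s. c * f s) = of_real ((cmod c)\<^sup>2) * ip f f"
    using assms complex_norm_square[of c] by (simp add: ip_scale_left ip_scale_right mult_ac)
  thus ?thesis by (simp add: hnorm_def real_sqrt_mult)
qed

lemma hnorm_minus_commute: "f \<in> H \<Longrightarrow> g \<in> H \<Longrightarrow> hnorm ip (\<lambda>s. f s - g s) = hnorm ip (\<lambda>s. g s - f s)"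
  using hnorm_scale[of "\<lambda>s. f s - g s" "-1"] by simp

text \<open>Pythagoras for the projection of \<open>r\<close> onto the line through
  \<open>y\<close>. Nonnegativity of the left side yields Cauchy-Schwarz; a lower bound for it by a
  squared distance yields orthogonality in \<open>dense_if_orthogonal_trivial\<close>.\<close>

lemma hnorm_sq_diff_projection:
  assumes r: "r \<in> H" and y: "y \<in> H" and ny: "hnorm ip y \<noteq> 0"
  defines "t \<equiv> ip r y / of_real ((hnorm ip y)\<^sup>2)"
  shows "(hnorm ip (\<lambda>s. r s - t * y s))\<^sup>2 = (hnorm ip r)\<^sup>2 - (cmod (ip r y))\<^sup>2 / (hnorm ip y)\<^sup>2"
proof -
  have "ip (\<lambda>s. r s - t * y s) (\<lambda>s. r s - t * y s) =
      ip r r - cnj t * ip r y - t * cnj (ip r y) + t * cnj t * ip y y"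
    using r y by (simp add: ip_diff_left ip_diff_right ip_scale_left ip_scale_right
        ip_commute[of r y] algebra_simps)
  also have "\<dots> = ip r r - ip r y * cnj (ip r y) / of_real ((hnorm ip y)\<^sup>2)"
    using ny y by (simp add: t_def ip_self power2_eq_square field_simps)
  also have "\<dots> = of_real ((hnorm ip r)\<^sup>2 - (cmod (ip r y))\<^sup>2 / (hnorm ip y)\<^sup>2)"
    using r by (simp add: ip_self complex_norm_square[symmetric])
  finally show ?thesis
    using r y by (simp add: hnorm_sq)
qed

lemma Cauchy_Schwarz:
  assumes "f \<in> H" "g \<in> H" shows "cmod (ip f g) \<le> hnorm ip f * hnorm ip g"
proof (cases "hnorm ip g = 0")
  case True
  then show ?thesis using assms by (simp add: hnorm_eq_0_iff)
next
  case False
  have "0 \<le> (hnorm ip f)\<^sup>2 - (cmod (ip f g))\<^sup>2 / (hnorm ip g)\<^sup>2"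
    by (metis hnorm_sq_diff_projection[OF assms False] zero_le_power2)
  hence "(cmod (ip f g))\<^sup>2 \<le> (hnorm ip f * hnorm ip g)\<^sup>2"
    using False by (simp add: field_simps power_mult_distrib)
  thus ?thesis
    using assms by (simp add: power2_le_iff_abs_le)
qed

lemma hnorm_triangle:
  assumes "f \<in> H" "g \<in> H"
  shows "hnorm ip (\<lambda>s. f s + g s) \<le> hnorm ip f + hnorm ip g"
proof -
  have "(hnorm ip (\<lambda>s. f s + g s))\<^sup>2 = (hnorm ip f)\<^sup>2 + (hnorm ip g)\<^sup>2 + 2 * Re (ip f g)"
    using assms by (simp add: hnorm_sq ip_add_left ip_add_right ip_commute[of f g])
  also have "\<dots> \<le> (hnorm ip f)\<^sup>2 + (hnorm ip g)\<^sup>2 + 2 * (hnorm ip f * hnorm ip g)"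
    using Cauchy_Schwarz[OF assms] complex_Re_le_cmod[of "ip f g"] by linarith
  also have "\<dots> = (hnorm ip f + hnorm ip g)\<^sup>2"
    by (simp add: power2_sum)
  finally show ?thesis
    using assms by (simp add: power2_le_iff_abs_le)
qed

lemma hnorm_diff_triangle:
  assumes "f \<in> H" "g \<in> H" "h \<in> H"
  shows "hnorm ip (\<lambda>s. f s - h s) \<le> hnorm ip (\<lambda>s. f s - g s) + hnorm ip (\<lambda>s. g s - h s)"
  using hnorm_triangle[of "\<lambda>s. f s - g s" "\<lambda>s. g s - h s"] assms by simp

lemma tendsto_hnorm:
  assumes "\<And>n. x n \<in> H" "f \<in> H" and lim: "(\<lambda>n. hnorm ip (\<lambda>s. x n s - f s)) \<longlonglongrightarrow> 0"
  shows "(\<lambda>n. hnorm ip (x n)) \<longlonglongrightarrow> hnorm ip f"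
proof (rule LIM_zero_cancel, rule tendsto_rabs_zero_cancel, rule tendsto_sandwich[OF _ _ tendsto_const lim])
  have "\<bar>hnorm ip (x n) - hnorm ip f\<bar> \<le> hnorm ip (\<lambda>s. x n s - f s)" for n
    using hnorm_triangle[of "\<lambda>s. x n s - f s" f] hnorm_triangle[of "\<lambda>s. f s - x n s" "x n"]
      hnorm_minus_commute[of f "x n"] assms by simp
  thus "\<forall>\<^sub>F n in sequentially. \<bar>hnorm ip (x n) - hnorm ip f\<bar> \<le> hnorm ip (\<lambda>s. x n s - f s)"
    by simp
qed auto

lemma tendsto_ip_left:
  assumes "\<And>n. x n \<in> H" "f \<in> H" "g \<in> H" and lim: "(\<lambda>n. hnorm ip (\<lambda>s. x n s - f s)) \<longlonglongrightarrow> 0"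
  shows "(\<lambda>n. ip (x n) g) \<longlonglongrightarrow> ip f g"
proof (rule LIM_zero_cancel, rule Lim_null_comparison)
  show "\<forall>\<^sub>F n in sequentially. norm (ip (x n) g - ip f g) \<le> hnorm ip (\<lambda>s. x n s - f s) * hnorm ip g"
    using assms Cauchy_Schwarz[of "\<lambda>s. x _ s - f s" g] by (simp add: ip_diff_left)
  show "(\<lambda>n. hnorm ip (\<lambda>s. x n s - f s) * hnorm ip g) \<longlonglongrightarrow> 0"
    using tendsto_mult_left_zero[OF lim] by simp
qed

lemma hnorm_parallelogram:
  assumes "f \<in> H" "g \<in> H"
  shows "(hnorm ip (\<lambda>s. f s + g s))\<^sup>2 + (hnorm ip (\<lambda>s. f s - g s))\<^sup>2 =
    2 * (hnorm ip f)\<^sup>2 + 2 * (hnorm ip g)\<^sup>2"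
  using assms by (simp add: hnorm_sq ip_add_left ip_add_right ip_diff_left ip_diff_right)

text \<open>Turns preservation of norms by the vertical translations into preservation of inner
  products.\<close>

lemma ip_polarization:
  assumes "f \<in> H" "g \<in> H"
  shows "4 * ip f g = of_real ((hnorm ip (\<lambda>s. f s + g s))\<^sup>2 - (hnorm ip (\<lambda>s. f s - g s))\<^sup>2)
     + \<i> * of_real ((hnorm ip (\<lambda>s. f s + \<i> * g s))\<^sup>2 - (hnorm ip (\<lambda>s. f s - \<i> * g s))\<^sup>2)"
  unfolding of_real_diff using assms
  by (simp add: ip_self[symmetric] ip_add_left ip_add_right ip_diff_left ip_diff_right
      ip_scale_left ip_scale_right algebra_simps del: of_real_power)

text \<open>A sequence in \<open>D\<close> minimizing the distance to \<open>f\<close> is Cauchy.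
  Its limit \<open>g\<close> lies in \<open>H\<close>, possibly outside \<open>D\<close>, but
  \<open>f - g\<close> is orthogonal to \<open>D\<close>. Hence \<open>f = g\<close>, and the
  sequence itself approximates \<open>f\<close>.\<close>

lemma dense_if_orthogonal_trivial:
  assumes D: "D \<subseteq> H" "(\<lambda>s. 0) \<in> D"
    and D_add: "\<And>f g. f \<in> D \<Longrightarrow> g \<in> D \<Longrightarrow> (\<lambda>s. f s + g s) \<in> D"
    and D_scale: "\<And>f c. f \<in> D \<Longrightarrow> (\<lambda>s. c * f s) \<in> D"
    and triv: "\<And>g. g \<in> H \<Longrightarrow> (\<And>d. d \<in> D \<Longrightarrow> ip g d = 0) \<Longrightarrow> g = (\<lambda>s. 0)"
  shows "dense_in H ip D"
  unfolding dense_in_def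
proof (intro conjI ballI allI impI)
  show "D \<subseteq> H" by fact
  fix f and e :: real
  assume f: "f \<in> H" and e: "0 < e"
  have DH: "g \<in> H" if "g \<in> D" for g using D that by blast
  define S where "S = (\<lambda>g. (hnorm ip (\<lambda>s. f s - g s))\<^sup>2) ` D"
  define d where "d = Inf S"
  have bdd: "bdd_below S" by (auto simp: S_def intro!: bdd_belowI[of _ 0])
  have ne: "S \<noteq> {}" using D by (auto simp: S_def)
  have d_le: "d \<le> (hnorm ip (\<lambda>s. f s - g s))\<^sup>2" if "g \<in> D" for g
    unfolding d_def by (rule cInf_lower[OF _ bdd]) (use that in \<open>auto simp: S_def\<close>)
  have "\<exists>g\<in>D. (hnorm ip (\<lambda>s. f s - g s))\<^sup>2 < d + 1 / real (Suc n)" for n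
  proof -
    have "Inf S < d + 1 / real (Suc n)" by (simp add: d_def)
    from cInf_lessD[OF ne this] show ?thesis by (auto simp: S_def)
  qed
  then obtain x where xD: "\<And>n. x n \<in> D"
    and x_lt: "\<And>n. (hnorm ip (\<lambda>s. f s - x n s))\<^sup>2 < d + 1 / real (Suc n)" by metis
  have xH: "x n \<in> H" for n using xD DH by blast
  have x_diff: "(hnorm ip (\<lambda>s. x m s - x n s))\<^sup>2 < 2 / real (Suc m) + 2 / real (Suc n)" for m n
  proof -
    \<comment> \<open>The midpoint of \<open>x m\<close> and \<open>x n\<close> competes in the
      infimum \<open>d\<close>, so the sum of the two residuals has squared norm at least
      \<open>4 * d\<close>. The parallelogram law then makes their difference small.\<close>
    have mid: "(\<lambda>s. (1/2) * (x m s + x n s)) \<in> D" by (intro D_scale D_add xD)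
    have "(\<lambda>s. (f s - x m s) + (f s - x n s)) = (\<lambda>s. 2 * (f s - (1/2) * (x m s + x n s)))"
      by (auto simp: algebra_simps)
    moreover have "hnorm ip (\<lambda>s. 2 * (f s - (1/2) * (x m s + x n s))) =
        2 * hnorm ip (\<lambda>s. f s - (1/2) * (x m s + x n s))"
      using hnorm_scale[OF diff_mem[OF f DH[OF mid]], of 2] by simp
    ultimately have "4 * d \<le> (hnorm ip (\<lambda>s. (f s - x m s) + (f s - x n s)))\<^sup>2"
      using d_le[OF mid] by (simp add: power_mult_distrib)
    moreover have "(\<lambda>s. (f s - x m s) - (f s - x n s)) = (\<lambda>s. x n s - x m s)" by auto
    ultimately show ?thesis
      using hnorm_parallelogram[OF diff_mem[OF f xH[of m]] diff_mem[OF f xH[of n]]]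
        x_lt[of m] x_lt[of n] hnorm_minus_commute[OF xH[of m] xH[of n]] by simp
  qed
  have cauchy: "\<exists>N. \<forall>m\<ge>N. \<forall>n\<ge>N. hnorm ip (\<lambda>s. x m s - x n s) < r" if r: "0 < r" for r
  proof -
    obtain N where N: "4 / r\<^sup>2 < real N" using reals_Archimedean2 by blast
    have "hnorm ip (\<lambda>s. x m s - x n s) < r" if "m \<ge> N" "n \<ge> N" for m n
    proof -
      have "0 < real N" using N r by (smt (verit) divide_pos_pos zero_less_power)
      hence "2 / real (Suc m) + 2 / real (Suc n) \<le> 2 / real N + 2 / real N"
        using that by (intro add_mono divide_left_mono) auto
      also have "\<dots> < r\<^sup>2" using N r \<open>0 < real N\<close> by (simp add: field_simps)
      finally have "(hnorm ip (\<lambda>s. x m s - x n s))\<^sup>2 < r\<^sup>2" using x_diff[of m n] by simp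
      thus ?thesis using r by (simp add: power_less_imp_less_base)
    qed
    thus ?thesis by blast
  qed
  obtain g where g: "g \<in> H" and lim: "(\<lambda>n. hnorm ip (\<lambda>s. x n s - g s)) \<longlonglongrightarrow> 0"
    using complete[OF xH cauchy] by blast
  have orth: "ip (\<lambda>s. f s - g s) y = 0" if y: "y \<in> D" for y
  proof (cases "hnorm ip y = 0")
    case True
    then show ?thesis using y DH f g by (simp add: hnorm_eq_0_iff)
  next
    case False
    have yH: "y \<in> H" using y DH by blast
    have bound: "(cmod (ip (\<lambda>s. f s - x n s) y))\<^sup>2 \<le> (hnorm ip y)\<^sup>2 * (1 / real (Suc n))" for n
    proof -
      \<comment> \<open>The best multiple of \<open>y\<close> to add to \<open>x n\<close>: the
        result cannot beat \<open>d\<close>, while \<open>x n\<close> exceeds \<open>d\<close> by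
        less than \<open>1 / Suc n\<close>, so the component of the residual along \<open>y\<close>
        is small.\<close>
      define t where "t = ip (\<lambda>s. f s - x n s) y / of_real ((hnorm ip y)\<^sup>2)"
      have "d \<le> (hnorm ip (\<lambda>s. f s - (x n s + t * y s)))\<^sup>2"
        by (intro d_le D_add D_scale xD y)
      also have "\<dots> = (hnorm ip (\<lambda>s. (f s - x n s) - t * y s))\<^sup>2"
        by (simp add: algebra_simps)
      also have "\<dots> = (hnorm ip (\<lambda>s. f s - x n s))\<^sup>2 - (cmod (ip (\<lambda>s. f s - x n s) y))\<^sup>2 / (hnorm ip y)\<^sup>2"
        unfolding t_def by (rule hnorm_sq_diff_projection) (use f xH yH False in auto)
      finally have "(cmod (ip (\<lambda>s. f s - x n s) y))\<^sup>2 / (hnorm ip y)\<^sup>2 \<le> 1 / real (Suc n)"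
        using x_lt[of n] by linarith
      thus ?thesis using False by (simp add: field_simps)
    qed
    have "(\<lambda>n. ip (\<lambda>s. f s - x n s) y) \<longlonglongrightarrow> ip (\<lambda>s. f s - g s) y"
      using tendsto_diff[OF tendsto_const[of "ip f y"] tendsto_ip_left[OF xH g yH lim]]
      by (simp add: ip_diff_left f g xH yH)
    hence "(\<lambda>n. (cmod (ip (\<lambda>s. f s - x n s) y))\<^sup>2) \<longlonglongrightarrow> (cmod (ip (\<lambda>s. f s - g s) y))\<^sup>2"
      by (intro tendsto_intros)
    moreover have "(\<lambda>n. (hnorm ip y)\<^sup>2 * (1 / real (Suc n))) \<longlonglongrightarrow> (hnorm ip y)\<^sup>2 * 0"
      using LIMSEQ_inverse_real_of_nat by (intro tendsto_intros) (simp add: inverse_eq_divide)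
    ultimately have "(cmod (ip (\<lambda>s. f s - g s) y))\<^sup>2 \<le> (hnorm ip y)\<^sup>2 * 0"
      by (rule LIMSEQ_le) (use bound in auto)
    thus ?thesis by simp
  qed
  have "(\<lambda>s. f s - g s) = (\<lambda>s. 0)" using triv[of "\<lambda>s. f s - g s"] orth f g by simp
  hence fg: "f = g" by (auto simp: fun_eq_iff)
  obtain n where "hnorm ip (\<lambda>s. x n s - g s) < e"
    using order_tendstoD(2)[OF lim e] by (auto simp: eventually_sequentially)
  thus "\<exists>g\<in>D. hnorm ip (\<lambda>s. f s - g s) < e"
    using xD hnorm_minus_commute[OF xH f] fg by auto
qed

end

subsection \<open>Characters of the positive integers\<close>

lemma cis_eq_cis_imp:
  assumes "cis x = cis y" obtains j :: int where "x = y + 2 * pi * of_int j"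
proof -
  have "exp (\<i> * of_real x) = exp (\<i> * of_real y)" using assms by (simp add: cis_conv_exp)
  then obtain j :: int where "\<i> * of_real x = \<i> * of_real y + (of_int (2 * j) * pi) * \<i>"
    by (auto simp: exp_eq)
  hence "Im (\<i> * of_real x) = Im (\<i> * of_real y + (of_int (2 * j) * pi) * \<i>)" by (rule arg_cong)
  thus ?thesis by (intro that[of j]) simp
qed

text \<open>A collision at \<open>m\<close> and \<open>n\<close> forces \<delta> to be an integer
  multiple of \<open>2 * pi / (ln m - ln n)\<close>. Only countably many reals are excluded in this
  way.\<close>

lemma exists_injective_character:
  obtains \<delta> :: real
  where "\<And>m n :: nat. 1 \<le> m \<Longrightarrow> 1 \<le> n \<Longrightarrow> m \<noteq> n \<Longrightarrow> cis (\<delta> * ln (real m)) \<noteq> cis (\<delta> * ln (real n))"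
proof -
  define S where "S = range (\<lambda>(m::nat, n::nat, j::int). 2 * pi * real_of_int j / (ln m - ln n))"
  have "countable S" unfolding S_def by (intro countable_image) auto
  hence "S \<noteq> UNIV" using uncountable_UNIV_real by metis
  then obtain \<delta> where \<delta>: "\<delta> \<notin> S" by blast
  show ?thesis
  proof (rule that[of \<delta>])
    fix m n :: nat
    assume mn: "1 \<le> m" "1 \<le> n" "m \<noteq> n"
    show "cis (\<delta> * ln m) \<noteq> cis (\<delta> * ln n)"
    proof
      assume "cis (\<delta> * ln m) = cis (\<delta> * ln n)"
      then obtain j :: int where "\<delta> * ln m = \<delta> * ln n + 2 * pi * of_int j"
        by (rule cis_eq_cis_imp)
      moreover have "ln (real m) \<noteq> ln (real n)" using mn by simp
      ultimately have "\<delta> = 2 * pi * of_int j / (ln m - ln n)" by (simp add: field_simps)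
      thus False using \<delta> unfolding S_def by (metis (mono_tags, lifting) case_prod_conv rangeI)
    qed
  qed
qed

section \<open>Dominated convergence and averages of powers on the unit circle\<close>

lemma tendsto_suminf_dominated:
  fixes f :: "nat \<Rightarrow> nat \<Rightarrow> real"
  assumes "\<And>n. (\<lambda>K. f n K) \<longlonglongrightarrow> g n" "\<And>n K. norm (f n K) \<le> M n" "summable M"
  shows "(\<lambda>K. \<Sum>n. f n K) \<longlonglongrightarrow> suminf g"
  using tannerys_theorem[of f g sequentially M] assms by (simp add: always_eventually)

lemma norm_average_powers_le_1:
  fixes z :: complex
  assumes "norm z = 1" shows "norm ((\<Sum>k<K. z ^ k) / of_nat K) \<le> 1"
proof (cases "K = 0")
  case False
  have "norm (\<Sum>k<K. z ^ k) \<le> (\<Sum>k<K. norm (z ^ k))" by (rule norm_sum)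
  also have "\<dots> = real K" using assms by (simp add: norm_power)
  finally show ?thesis using False by (simp add: norm_divide field_simps)
qed simp

text \<open>For \<open>z\<close> other than 1 the geometric sums stay bounded by
  \<open>2 / norm (z - 1)\<close>, so division by \<open>K\<close> sends them to 0. This is the
  device that isolates single entries in \<open>zero_on_line_imp_zero\<close>.\<close>

lemma average_powers_tendsto:
  fixes z :: complex
  assumes "norm z = 1"
  shows "(\<lambda>K. (\<Sum>k<K. z ^ k) / of_nat K) \<longlonglongrightarrow> (if z = 1 then 1 else 0)"
proof (cases "z = 1")
  case True
  have "\<forall>\<^sub>F K in sequentially. (\<Sum>k<K. z ^ k) / of_nat K = 1"
    using eventually_gt_at_top[of 0] by eventually_elim (use True in simp)
  thus ?thesis using True by (simp add: tendsto_eventually)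
next
  case False
  have le: "norm ((\<Sum>k<K. z ^ k) / of_nat K) \<le> 2 / norm (z - 1) * (1 / real K)" for K
  proof -
    have "(\<Sum>k<K. z ^ k) = (z ^ K - 1) / (z - 1)"
      using False geometric_sum by blast
    moreover have "norm (z ^ K - 1) \<le> 2"
      using norm_triangle_ineq4[of "z ^ K" 1] assms by (simp add: norm_power)
    ultimately show ?thesis
      by (simp add: norm_divide norm_mult divide_right_mono)
  qed
  have lim: "(\<lambda>K. 2 / norm (z - 1) * (1 / real K)) \<longlonglongrightarrow> 0"
    using tendsto_mult_right_zero[OF lim_1_over_n] by blast
  have "(\<lambda>K. (\<Sum>k<K. z ^ k) / of_nat K) \<longlonglongrightarrow> 0"
    by (rule Lim_null_comparison[OF always_eventually lim]) (rule allI, rule le)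
  thus ?thesis using False by simp
qed

text \<open>If both pairs agreed, \<open>(b - c) * ln p\<close> and \<open>(b - c) * ln q\<close>
  would be nonzero integer multiples of \<open>2 * pi\<close>. Then nontrivial powers of
  \<open>p\<close> and \<open>q\<close> would coincide, against coprimality.\<close>

lemma coprime_characters_separate:
  fixes p q :: nat
  assumes "coprime p q" "1 < p" "1 < q" "b \<noteq> c"
  shows "cis (b * ln p) \<noteq> cis (c * ln p) \<or> cis (b * ln q) \<noteq> cis (c * ln q)"
proof (rule ccontr)
  assume "\<not> ?thesis"
  then obtain i j :: int where "b * ln p = c * ln p + 2 * pi * of_int i"
      "b * ln q = c * ln q + 2 * pi * of_int j"
    by (metis cis_eq_cis_imp)
  hence ij: "(b - c) * ln p = 2 * pi * of_int i" "(b - c) * ln q = 2 * pi * of_int j"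
    by (simp_all add: algebra_simps)
  have lns: "0 < ln (real p)" "0 < ln (real q)" using assms by simp_all
  have i0: "i \<noteq> 0" using ij(1) lns assms by auto
  \<comment> \<open>Cross-multiplication eliminates \<open>2 * pi\<close> and leaves an integer
    relation between \<open>ln p\<close> and \<open>ln q\<close>.\<close>
  have "((b - c) * ln p) * of_int j = ((b - c) * ln q) * of_int i"
    unfolding ij by simp
  hence "(b - c) * (of_int j * ln p) = (b - c) * (of_int i * ln q)"
    by (simp only: mult_ac)
  hence "of_int j * ln p = of_int i * ln q" using assms by simp
  \<comment> \<open>Absolute values remove the signs of \<open>i\<close> and \<open>j\<close>, so
    that they can serve as natural exponents.\<close>
  hence "\<bar>of_int j * ln p\<bar> = \<bar>of_int i * ln q\<bar>" by simp
  hence "real (nat \<bar>j\<bar>) * ln p = real (nat \<bar>i\<bar>) * ln q"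
    using lns by (simp add: abs_mult)
  hence "ln (real (p ^ nat \<bar>j\<bar>)) = ln (real (q ^ nat \<bar>i\<bar>))"
    using assms by (simp add: ln_realpow)
  hence "real (p ^ nat \<bar>j\<bar>) = real (q ^ nat \<bar>i\<bar>)"
    using assms by (subst (asm) ln_inj_iff) auto
  hence "p ^ nat \<bar>j\<bar> = q ^ nat \<bar>i\<bar>" by (simp only: of_nat_eq_iff)
  hence "coprime (q ^ nat \<bar>i\<bar>) (q ^ nat \<bar>i\<bar>)"
    using assms(1) by (metis coprime_power_left_iff coprime_power_right_iff)
  hence "q ^ nat \<bar>i\<bar> = 1" by simp
  thus False using i0 assms by simp
qed

text \<open>Artin's argument: comparing the relation at \<open>n\<close> with the one at \<open>p * n\<close> (or \<open>q * n\<close>)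
  eliminates one character.\<close>

lemma characters_independent:
  fixes c :: "real \<Rightarrow> complex" and S :: "nat set"
  assumes closed: "\<And>m n. m \<in> S \<Longrightarrow> n \<in> S \<Longrightarrow> m * n \<in> S"
    and pq: "p \<in> S" "q \<in> S" "1 < p" "1 < q" "coprime p q" and pos: "0 \<notin> S"
    and "finite B"
    and "\<And>n. n \<in> S \<Longrightarrow> (\<Sum>b\<in>B. c b * cis (b * ln n)) = 0" and "b \<in> B"
  shows "c b = 0"
  using assms(8-)
proof (induction B arbitrary: c b rule: finite_induct)
  case (insert b0 B)
  have elim: "c b * (cis (b * ln r) - cis (b0 * ln r)) = 0" if "r \<in> S" "b \<in> B" for r b
  proof (rule insert.IH[OF _ \<open>b \<in> B\<close>])
    fix n assume n: "n \<in> S"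
    have "0 < n \<and> 0 < r" using pos n \<open>r \<in> S\<close> by (metis gr0I)
    hence "cis (b * ln (real (r * n))) = cis (b * ln r) * cis (b * ln n)" for b
      by (simp add: cis_mult ln_mult algebra_simps)
    with insert.prems(1)[OF closed[OF \<open>r \<in> S\<close> n]]
    have 1: "(\<Sum>b\<in>insert b0 B. c b * (cis (b * ln r) * cis (b * ln n))) = 0" by simp
    have 2: "(\<Sum>b\<in>insert b0 B. c b * (cis (b0 * ln r) * cis (b * ln n))) = 0"
      using arg_cong[OF insert.prems(1)[OF n], of "\<lambda>x. cis (b0 * ln r) * x"]
      by (simp only: sum_distrib_left mult_zero_right) (simp add: mult_ac)
    have "(\<Sum>b\<in>insert b0 B. c b * (cis (b * ln r) - cis (b0 * ln r)) * cis (b * ln n)) = 0"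
      using 1 2 by (simp add: algebra_simps sum_subtractf del: sum.insert)
    thus "(\<Sum>b\<in>B. c b * (cis (b * ln r) - cis (b0 * ln r)) * cis (b * ln n)) = 0"
      using insert.hyps by simp
  qed
  have B0: "c b = 0" if "b \<in> B" for b
  proof -
    have "b \<noteq> b0" using that insert.hyps by auto
    \<comment> \<open>At least one of the choices \<open>r = p\<close> and \<open>r = q\<close>
      makes the factor in \<open>elim\<close> nonzero.\<close>
    from coprime_characters_separate[OF pq(5,3,4) this]
    show ?thesis using elim[OF pq(1) that] elim[OF pq(2) that] by auto
  qed
  hence "c b0 = 0" using insert.prems(1)[OF pq(1)] insert.hyps by simp
  thus ?case using B0 insert.prems(2) by auto
qed simp

text \<open>Dirichlet's simultaneous approximation applied to \<open>N * ln n\<close> rather than \<open>ln n\<close> makes the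
  approximating times unbounded.\<close>

lemma exists_recurrence_times:
  obtains \<tau> :: "nat \<Rightarrow> real" where "filterlim \<tau> at_top sequentially"
    "\<And>n::nat. (\<lambda>N. cis (\<tau> N * ln n)) \<longlonglongrightarrow> 1"
proof -
  have "\<exists>t::real. real N \<le> t \<and> (\<forall>n<N. norm (cis (t * ln (real n)) - 1) \<le> 2 * pi / real N)"
    if N: "0 < N" for N :: nat
  proof -
    obtain q p where q: "0 < q" and
      qp: "\<And>n. n < N \<Longrightarrow> \<bar>of_int q * (real N * ln (real n)) - of_int (p n)\<bar> < 1 / real N"
      using Dirichlet_approx_simult[OF N, where \<theta>="\<lambda>n. real N * ln (real n)" and n=N] by metis
    \<comment> \<open>In units of \<open>2 * pi\<close>, the angle \<open>t * ln n\<close> is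
      \<open>q * (N * ln n)\<close>, which is within \<open>1 / N\<close> of an integer;
      \<open>q >= 1\<close> gives \<open>t >= N\<close>.\<close>
    define t where "t = 2 * pi * of_int q * real N"
    have "1 * real N \<le> t" unfolding t_def
      using q pi_ge_two mult_mono[of 1 "2 * pi" 1 "real_of_int q"]
      by (intro mult_right_mono) auto
    moreover have "norm (cis (t * ln (real n)) - 1) \<le> 2 * pi / real N" if "n < N" for n
    proof -
      define x where "x = of_int q * (real N * ln (real n)) - of_int (p n)"
      have "t * ln (real n) = 2 * pi * x + 2 * pi * of_int (p n)"
        by (simp add: t_def x_def algebra_simps)
      hence "cis (t * ln (real n)) = cis (2 * pi * x)"
        by (simp add: cis_mult[symmetric])
      also have "norm (cis (2 * pi * x) - 1) \<le> \<bar>2 * pi * x\<bar>"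
        using dist_exp_i_1[of "2 * pi * x"] abs_sin_x_le_abs_x[of "2 * pi * x / 2"]
        by (simp add: cis_conv_exp)
      also have "\<dots> \<le> 2 * pi * (1 / real N)"
        using mult_left_mono[OF less_imp_le[OF qp[OF that]], of "2 * pi"] by (simp add: abs_mult x_def)
      finally show ?thesis by simp
    qed
    ultimately show ?thesis by auto
  qed
  then obtain \<tau> where \<tau>: "\<And>N. 0 < N \<Longrightarrow> real N \<le> \<tau> N"
    "\<And>N n. 0 < N \<Longrightarrow> n < N \<Longrightarrow> norm (cis (\<tau> N * ln (real n)) - 1) \<le> 2 * pi / real N"
    by metis
  show ?thesis
  proof (rule that)
    show "filterlim \<tau> at_top sequentially"
      by (rule filterlim_at_top_mono[OF filterlim_real_sequentially])
        (use \<tau>(1) in \<open>auto intro: eventually_sequentiallyI[of 1]\<close>)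
    fix n :: nat
    show "(\<lambda>N. cis (\<tau> N * ln n)) \<longlonglongrightarrow> 1"
    proof (rule LIM_zero_cancel, rule Lim_null_comparison)
      show "\<forall>\<^sub>F N in sequentially. norm (cis (\<tau> N * ln n) - 1) \<le> 2 * pi * (1 / real N)"
        using \<tau>(2) by (auto intro: eventually_sequentiallyI[of "Suc n"])
      show "(\<lambda>N. 2 * pi * (1 / real N)) \<longlonglongrightarrow> 0"
        using tendsto_mult_right_zero[OF lim_1_over_n] by blast
    qed
  qed
qed

subsection \<open>Dirichlet series kernels\<close>

text \<open>The \<open>n\<close>-th entry of the vector that represents the kernel at
  \<open>u\<close> in the weighted sequence space. With \<open>u\<close> conjugated, the value at
  \<open>s\<close> of the kernel at \<open>u\<close> is the weighted inner product of the vectors of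
  \<open>u\<close> and \<open>s\<close>, in this order.\<close>

definition ncoef :: "nat \<Rightarrow> complex \<Rightarrow> complex" where
  "ncoef n u = of_nat n powr (- cnj u)"

lemma ncoef_0 [simp]: "ncoef 0 u = 0"
  by (simp add: ncoef_def)

lemma ncoef_nonzero: "1 \<le> n \<Longrightarrow> ncoef n u \<noteq> 0"
  by (simp add: ncoef_def)

lemma ncoef_vertical_shift: "ncoef n (u + \<i> * of_real c) = ncoef n u * cis (c * ln n)"
proof (cases "n = 0")
  case False
  have "- cnj (u + \<i> * of_real c) = - cnj u + \<i> * of_real c" by simp
  hence "ncoef n (u + \<i> * of_real c) = ncoef n u * (of_nat n powr (\<i> * of_real c))"
    unfolding ncoef_def by (simp only: powr_add)
  also have "of_nat n powr (\<i> * complex_of_real c) = cis (c * ln n)"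
    using False Ln_of_real[of "real n"] by (simp add: powr_def cis_conv_exp mult_ac)
  finally show ?thesis .
qed simp

lemma powr_kernel_eq_ncoef: "of_nat n powr (- (s + cnj u)) = ncoef n u * cnj (ncoef n s)"
proof -
  have "cnj (ncoef n s) = of_nat n powr (- s)"
    by (simp add: ncoef_def cnj_powr)
  moreover have "- (s + cnj u) = - cnj u + - s" by simp
  ultimately show ?thesis unfolding ncoef_def by (simp only: powr_add)
qed

locale dirichlet_rkhs =
  fixes \<rho> :: real and a :: "nat \<Rightarrow> real"
    and H :: "(complex \<Rightarrow> complex) set"
    and ip :: "(complex \<Rightarrow> complex) \<Rightarrow> (complex \<Rightarrow> complex) \<Rightarrow> complex"
  assumes nonneg: "\<And>n. 1 \<le> n \<Longrightarrow> 0 \<le> a n"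
    and conv: "\<And>s u. \<rho> < Re s \<Longrightarrow> \<rho> < Re u \<Longrightarrow>
      summable (\<lambda>n. complex_of_real (a n) * of_nat n powr (- (s + cnj u)))"
    and rkhs: "is_rkhs \<rho> (dkernel a) H ip"
begin

sublocale function_hilbert H ip
  by unfold_locales (use rkhs in \<open>simp add: is_rkhs_def\<close>)

abbreviation k :: "complex \<Rightarrow> complex \<Rightarrow> complex" where "k \<equiv> kfun \<rho> a"

lemma vanishing: "f \<in> H \<Longrightarrow> Re s \<le> \<rho> \<Longrightarrow> f s = 0"
  and k_mem: "\<rho> < Re u \<Longrightarrow> k u \<in> H"
  and reproducing: "f \<in> H \<Longrightarrow> \<rho> < Re u \<Longrightarrow> ip f (k u) = f u"
  using rkhs by (auto simp: is_rkhs_def kfun_def)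

lemma k_sums:
  assumes "\<rho> < Re s" "\<rho> < Re u"
  shows "(\<lambda>n. of_real (a n) * (ncoef n u * cnj (ncoef n s))) sums k u s"
  using summable_sums[OF conv[OF assms]] assms(1)
  by (simp add: kfun_def dkernel_def flip: powr_kernel_eq_ncoef)

lemma weight_nonneg: "0 \<le> a n * (cmod (ncoef n u * x))\<^sup>2"
  by (cases "n = 0") (auto simp: nonneg)

text \<open>By the reproducing property \<open>ip x x\<close> is a Gram sum of kernel values.
  Inserting the series and collecting the finite sums term by term gives squared moduli. This is the
  isometry into the sequence space, and it carries all later norm computations.\<close>

lemma hnorm_combination_sums:
  assumes u: "\<And>j. j \<in> J \<Longrightarrow> \<rho> < Re (u j)"
  shows "(\<lambda>n. a n * (cmod (\<Sum>j\<in>J. c j * ncoef n (u j)))\<^sup>2) sums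
    (hnorm ip (\<lambda>s. \<Sum>j\<in>J. c j * k (u j) s))\<^sup>2"
proof -
  define x where "x = (\<lambda>s. \<Sum>j\<in>J. c j * k (u j) s)"
  have x: "x \<in> H" unfolding x_def using u by (intro sum_mem k_mem)
  have "ip x x = (\<Sum>i\<in>J. cnj (c i) * ip x (k (u i)))"
    by (subst (2) x_def) (use u x in \<open>auto intro!: ip_sum_right k_mem\<close>)
  also have "\<dots> = (\<Sum>i\<in>J. cnj (c i) * (\<Sum>j\<in>J. c j * k (u j) (u i)))"
    using u x by (auto intro!: sum.cong simp: reproducing) (simp add: x_def)
  finally have ip_x: "ip x x = (\<Sum>i\<in>J. cnj (c i) * (\<Sum>j\<in>J. c j * k (u j) (u i)))" .
  have "(\<lambda>n. \<Sum>i\<in>J. cnj (c i) * (\<Sum>j\<in>J. c j * (of_real (a n) * (ncoef n (u j) * cnj (ncoef n (u i))))))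
      sums ip x x"
    unfolding ip_x using u by (intro sums_sum sums_mult k_sums)
  moreover have "(\<Sum>i\<in>J. cnj (c i) * (\<Sum>j\<in>J. c j * (of_real (a n) * (ncoef n (u j) * cnj (ncoef n (u i))))))
      = of_real (a n * (cmod (\<Sum>j\<in>J. c j * ncoef n (u j)))\<^sup>2)" for n
  proof -
    have "of_real (a n * (cmod (\<Sum>j\<in>J. c j * ncoef n (u j)))\<^sup>2) =
      of_real (a n) * ((\<Sum>j\<in>J. c j * ncoef n (u j)) * cnj (\<Sum>j\<in>J. c j * ncoef n (u j)))"
      by (simp only: of_real_mult complex_norm_square)
    also have "\<dots> = (\<Sum>i\<in>J. cnj (c i) * (\<Sum>j\<in>J. c j * (of_real (a n) * (ncoef n (u j) * cnj (ncoef n (u i))))))"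
      by (simp add: sum_distrib_left sum_distrib_right mult_ac)
    finally show ?thesis by simp
  qed
  ultimately have "(\<lambda>n. complex_of_real (a n * (cmod (\<Sum>j\<in>J. c j * ncoef n (u j)))\<^sup>2)) sums ip x x"
    by simp
  hence "(\<lambda>n. a n * (cmod (\<Sum>j\<in>J. c j * ncoef n (u j)))\<^sup>2) sums Re (ip x x)"
    using sums_Re by fastforce
  thus ?thesis using x by (simp add: hnorm_sq flip: x_def)
qed

lemma hnorm_k_sums:
  assumes "\<rho> < Re u" shows "(\<lambda>n. a n * (cmod (ncoef n u))\<^sup>2) sums (hnorm ip (k u))\<^sup>2"
  using hnorm_combination_sums[of "{()}" "\<lambda>_. u" "\<lambda>_. 1"] assms by simp

lemma hnorm_diff_k_sums:
  assumes "\<rho> < Re u" "\<rho> < Re v"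
  shows "(\<lambda>n. a n * (cmod (ncoef n u - ncoef n v))\<^sup>2) sums (hnorm ip (\<lambda>s. k u s - k v s))\<^sup>2"
  using hnorm_combination_sums[of UNIV "\<lambda>j. if j then u else v" "\<lambda>j. if j then 1 else -1"] assms
  by (simp add: UNIV_bool)

lemma tendsto_eval:
  assumes "\<And>n. x n \<in> H" "f \<in> H" "(\<lambda>n. hnorm ip (\<lambda>s. x n s - f s)) \<longlonglongrightarrow> 0" "\<rho> < Re s"
  shows "(\<lambda>n. x n s) \<longlonglongrightarrow> f s"
  using tendsto_ip_left[OF assms(1,2) k_mem[OF assms(4)] assms(3)]
  by (simp add: reproducing assms)

text \<open>Kernels on the line may be subtracted from \<open>k u\<close> without changing its
  pairing with \<open>f\<close>, since \<open>f\<close> vanishes there. Suitable ones cancel the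
  first \<open>N\<close> entries of \<open>k u\<close> in the limit, so Cauchy-Schwarz bounds
  \<open>f u\<close> by the tail of a convergent series.\<close>

lemma zero_on_line_imp_zero:
  assumes f: "f \<in> H" and \<alpha>: "\<rho> < \<alpha>" and zero: "\<And>b. f (of_real \<alpha> + \<i> * of_real b) = 0"
  shows "f = (\<lambda>s. 0)"
proof
  fix u
  show "f u = 0"
  proof (cases "\<rho> < Re u")
    case False
    thus ?thesis using vanishing[OF f] by simp
  next
    case u: True
    obtain \<delta> :: real where \<delta>:
      "\<And>m n :: nat. 1 \<le> m \<Longrightarrow> 1 \<le> n \<Longrightarrow> m \<noteq> n \<Longrightarrow> cis (\<delta> * ln (real m)) \<noteq> cis (\<delta> * ln (real n))"
      using exists_injective_character by blast
    define z where "z n = cis (\<delta> * ln (real n))" for n :: nat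
    have z_nz [simp]: "z n \<noteq> 0" for n by (simp add: z_def)
    have z_norm [simp]: "norm (z n) = 1" for n by (simp add: z_def)
    have z_inj: "z m \<noteq> z n" if "1 \<le> m" "1 \<le> n" "m \<noteq> n" for m n
      unfolding z_def using \<delta> that by blast
    define A where "A = complex_of_real \<alpha>"
    have A: "\<rho> < Re A" using \<alpha> by (simp add: A_def)
    have ncoef_line: "ncoef n (A + \<i> * of_real (real j * \<delta>)) = ncoef n A * z n ^ j" for n j
      by (simp only: ncoef_vertical_shift z_def Complex.DeMoivre mult.assoc)
    \<comment> \<open>For \<open>n >= 1\<close>, \<open>ncoef n A * G n\<close> is the entry of
      \<open>k u\<close>. As \<open>K\<close> grows, \<open>P N K n\<close> tends to
      \<open>G n\<close> if \<open>n < N\<close> and to 0 otherwise; \<open>E N K n\<close> is what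
      entry \<open>n\<close> still contributes to the squared norm.\<close>
    define G where "G m = ncoef m u / ncoef m A" for m
    define avg where "avg K w = (\<Sum>j<K. w ^ j) / complex_of_nat K" for K w
    define P where "P N K n = (\<Sum>m<N. G m * avg K (z n / z m))" for N K n :: nat
    define E where "E N K n = a n * (cmod (ncoef n u - ncoef n A * P N K n))\<^sup>2" for N K n
    define v where "v n = a n * (cmod (ncoef n u))\<^sup>2" for n
    have v_summable: "summable v" unfolding v_def using hnorm_k_sums[OF u] by (rule sums_summable)
    have w_summable: "summable (\<lambda>n. a n * (cmod (ncoef n A))\<^sup>2)"
      using hnorm_k_sums[OF A] by (rule sums_summable)

    have bound: "(cmod (f u))\<^sup>2 \<le> (hnorm ip f)\<^sup>2 * suminf (E N K)" for N K
    proof -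
      \<comment> \<open>Weight \<open>1 / K\<close> at each height \<open>j * \<delta>\<close>,
        twisted by the inverse of \<open>z m ^ j\<close> so that averaging detects entry
        \<open>m\<close>. Index 0 of \<open>c\<close> and \<open>p\<close> is reserved for
        \<open>k u\<close> itself, hence \<open>case_nat\<close>.\<close>
      define C where "C j = (\<Sum>m<N. G m / (of_nat K * z m ^ j))" for j
      define c where "c = case_nat 1 (\<lambda>j. - C j)"
      define p where "p = case_nat u (\<lambda>j. A + \<i> * of_real (real j * \<delta>))"
      define x where "x = (\<lambda>s. \<Sum>j<Suc K. c j * k (p j) s)"
      have p: "\<rho> < Re (p j)" for j using u A by (cases j) (auto simp: p_def)
      have x: "x \<in> H" unfolding x_def using p by (intro sum_mem k_mem)
      have coef: "(\<Sum>j<Suc K. c j * ncoef n (p j)) = ncoef n u - ncoef n A * P N K n" for n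
      proof -
        have "(\<Sum>j<Suc K. c j * ncoef n (p j)) = ncoef n u - (\<Sum>j<K. C j * (ncoef n A * z n ^ j))"
          by (simp add: sum.lessThan_Suc_shift c_def p_def ncoef_line sum_negf del: sum.lessThan_Suc of_real_mult)
        also have "(\<Sum>j<K. C j * (ncoef n A * z n ^ j)) =
            ncoef n A * (\<Sum>j<K. \<Sum>m<N. G m * ((z n / z m) ^ j / of_nat K))"
          by (simp add: C_def sum_distrib_left sum_distrib_right power_divide field_simps)
        also have "(\<Sum>j<K. \<Sum>m<N. G m * ((z n / z m) ^ j / of_nat K)) = P N K n"
          by (subst sum.swap) (simp add: P_def avg_def sum_distrib_left sum_divide_distrib)
        finally show ?thesis .
      qed
      have "(\<lambda>n. a n * (cmod (\<Sum>j<Suc K. c j * ncoef n (p j)))\<^sup>2) sums (hnorm ip x)\<^sup>2"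
        unfolding x_def using p by (intro hnorm_combination_sums)
      hence "suminf (E N K) = (hnorm ip x)\<^sup>2"
        unfolding coef E_def by (rule sums_unique[symmetric])
      moreover have "ip f x = f u"
      proof -
        have "ip f x = (\<Sum>j<Suc K. cnj (c j) * ip f (k (p j)))"
          unfolding x_def using p f by (intro ip_sum_right k_mem)
        also have "\<dots> = (\<Sum>j<Suc K. cnj (c j) * f (p j))"
          using p f by (simp add: reproducing)
        also have "\<dots> = f u"
          using zero[of "real _ * \<delta>"]
          by (simp add: sum.lessThan_Suc_shift c_def p_def A_def del: sum.lessThan_Suc of_real_mult)
        finally show ?thesis .
      qed
      ultimately show ?thesis
        using power_mono[OF Cauchy_Schwarz[OF f x], of 2] by (simp add: power_mult_distrib)
    qed

    have P_lim: "(\<lambda>K. P N K n) \<longlonglongrightarrow> (if n < N then G n else 0)" if n: "1 \<le> n" for N n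
    proof -
      have "(\<lambda>K. P N K n) \<longlonglongrightarrow> (\<Sum>m<N. G m * (if z n / z m = 1 then 1 else 0))"
        unfolding P_def avg_def
        by (intro tendsto_sum tendsto_mult tendsto_const average_powers_tendsto)
          (simp add: norm_divide)
      also have "(\<Sum>m<N. G m * (if z n / z m = 1 then 1 else 0)) = (\<Sum>m<N. if m = n then G m else 0)"
      proof (rule sum.cong[OF refl])
        fix m
        \<comment> \<open>Since \<open>ln 0 = 0\<close>, \<open>z 0\<close> coincides with
          \<open>z 1\<close>, and injectivity of \<open>z\<close> starts at 1. The term for
          \<open>m = 0\<close> disappears because \<open>G 0 = 0\<close>.\<close>
        show "G m * (if z n / z m = 1 then 1 else 0) = (if m = n then G m else 0)"
          using z_inj[of m n] n by (cases "m = 0") (auto simp: G_def)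
      qed
      finally show ?thesis by simp
    qed
    have E_lim: "(\<lambda>K. E N K n) \<longlonglongrightarrow> (if n < N then 0 else v n)" for N n
    proof (cases "n = 0")
      case False
      have "(\<lambda>K. E N K n) \<longlonglongrightarrow> a n * (cmod (ncoef n u - ncoef n A * (if n < N then G n else 0)))\<^sup>2"
        unfolding E_def by (intro tendsto_intros P_lim) (use False in simp)
      thus ?thesis using False ncoef_nonzero[of n A] by (auto simp: v_def G_def split: if_splits)
    qed (simp add: E_def v_def)
    \<comment> \<open>The averages have modulus at most 1, so \<open>P N K n\<close> is bounded
      uniformly in \<open>K\<close> and \<open>n\<close>. The majorant is summable because
      \<open>k u\<close> and \<open>k A\<close> have finite norm.\<close>
    have E_bound: "norm (E N K n) \<le> 2 * v n + 2 * (\<Sum>m<N. cmod (G m))\<^sup>2 * (a n * (cmod (ncoef n A))\<^sup>2)" for N K n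
    proof (cases "n = 0")
      case False
      hence an: "0 \<le> a n" using nonneg by simp
      have "cmod (P N K n) \<le> (\<Sum>m<N. cmod (G m * avg K (z n / z m)))"
        unfolding P_def by (rule norm_sum)
      also have "\<dots> \<le> (\<Sum>m<N. cmod (G m))"
        unfolding norm_mult avg_def
        by (intro sum_mono mult_left_le norm_average_powers_le_1) (auto simp: norm_divide)
      finally have "(cmod (P N K n))\<^sup>2 \<le> (\<Sum>m<N. cmod (G m))\<^sup>2" by (simp add: power_mono)
      hence "2 * (cmod (ncoef n A))\<^sup>2 * (cmod (P N K n))\<^sup>2 \<le> 2 * (cmod (ncoef n A))\<^sup>2 * (\<Sum>m<N. cmod (G m))\<^sup>2"
        by (intro mult_left_mono) auto
      moreover have "(cmod (ncoef n u - ncoef n A * P N K n))\<^sup>2 \<le> (cmod (ncoef n u) + cmod (ncoef n A * P N K n))\<^sup>2"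
        by (intro power_mono norm_triangle_ineq4) auto
      moreover have "(cmod (ncoef n u) + cmod (ncoef n A * P N K n))\<^sup>2 \<le>
          2 * (cmod (ncoef n u))\<^sup>2 + 2 * (cmod (ncoef n A * P N K n))\<^sup>2"
        using sum_squares_bound[of "cmod (ncoef n u)" "cmod (ncoef n A * P N K n)"]
        by (simp add: power2_sum)
      ultimately have "(cmod (ncoef n u - ncoef n A * P N K n))\<^sup>2 \<le>
          2 * (cmod (ncoef n u))\<^sup>2 + 2 * (cmod (ncoef n A))\<^sup>2 * (\<Sum>m<N. cmod (G m))\<^sup>2"
        unfolding norm_mult power_mult_distrib by linarith
      from mult_left_mono[OF this an] show ?thesis
        using an by (simp add: E_def v_def algebra_simps)
    qed (simp add: E_def v_def)
    \<comment> \<open>The majorant depends on \<open>N\<close>, so \<open>K\<close> tends to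
      infinity first with \<open>N\<close> fixed, and \<open>N\<close> only afterwards.\<close>
    have tail: "(cmod (f u))\<^sup>2 \<le> (hnorm ip f)\<^sup>2 * (suminf v - (\<Sum>n<N. v n))" for N
    proof -
      have "(\<lambda>K. suminf (E N K)) \<longlonglongrightarrow> (\<Sum>n. if n < N then 0 else v n)"
        by (rule tendsto_suminf_dominated[OF E_lim E_bound])
          (intro summable_add summable_mult v_summable w_summable)
      moreover have "(\<Sum>n. if n < N then 0 else v n) = suminf v - (\<Sum>n<N. v n)"
      proof -
        have "(\<lambda>n. v n - (if n \<in> {..<N} then v n else 0)) sums (suminf v - (\<Sum>n<N. v n))"
          by (intro sums_diff summable_sums v_summable sums_If_finite_set) auto
        moreover have "(\<lambda>n. v n - (if n \<in> {..<N} then v n else 0)) = (\<lambda>n. if n < N then 0 else v n)"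
          by auto
        ultimately show ?thesis by (simp add: sums_iff)
      qed
      ultimately have "(\<lambda>K. (hnorm ip f)\<^sup>2 * suminf (E N K)) \<longlonglongrightarrow>
          (hnorm ip f)\<^sup>2 * (suminf v - (\<Sum>n<N. v n))"
        by (intro tendsto_intros) simp
      thus ?thesis by (rule LIMSEQ_le_const) (use bound in auto)
    qed
    have "(\<lambda>N. (hnorm ip f)\<^sup>2 * (suminf v - (\<Sum>n<N. v n))) \<longlonglongrightarrow>
        (hnorm ip f)\<^sup>2 * (suminf v - suminf v)"
      by (intro tendsto_intros summable_LIMSEQ v_summable)
    hence "(cmod (f u))\<^sup>2 \<le> (hnorm ip f)\<^sup>2 * (suminf v - suminf v)"
      by (rule LIMSEQ_le_const) (use tail in auto)
    thus ?thesis by simp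
  qed
qed

text \<open>Dominated convergence: each factor \<open>cis (\<tau> N * ln n) - 1\<close> tends to 0
  and has modulus at most 2, so four times the series of \<open>k u\<close> is a majorant.\<close>

lemma hnorm_k_recurrence:
  assumes u: "\<rho> < Re u" and \<tau>: "\<And>n::nat. (\<lambda>N. cis (\<tau> N * ln n)) \<longlonglongrightarrow> 1"
  shows "(\<lambda>N::nat. hnorm ip (\<lambda>s. k (u + \<i> * of_real (\<tau> N)) s - k u s)) \<longlonglongrightarrow> 0"
proof -
  define E where "E n N = a n * (cmod (ncoef n u * (cis (\<tau> N * ln n) - 1)))\<^sup>2" for n N :: nat
  have hn: "hnorm ip (\<lambda>s. k (u + \<i> * of_real (\<tau> N)) s - k u s) = sqrt (\<Sum>n. E n N)" for N
  proof -
    have v: "\<rho> < Re (u + \<i> * of_real (\<tau> N))" using u by simp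
    have "(\<lambda>n. E n N) sums (hnorm ip (\<lambda>s. k (u + \<i> * of_real (\<tau> N)) s - k u s))\<^sup>2"
      using hnorm_diff_k_sums[OF v u] by (simp add: E_def ncoef_vertical_shift algebra_simps)
    hence "(\<Sum>n. E n N) = (hnorm ip (\<lambda>s. k (u + \<i> * of_real (\<tau> N)) s - k u s))\<^sup>2"
      by (simp add: sums_iff)
    thus ?thesis using k_mem[OF u] k_mem[OF v] by simp
  qed
  have E_lim: "(\<lambda>N. E n N) \<longlonglongrightarrow> a n * (cmod (ncoef n u * (1 - 1)))\<^sup>2" for n
    unfolding E_def by (intro tendsto_intros \<tau>)
  have E_bound: "norm (E n N) \<le> 4 * (a n * (cmod (ncoef n u))\<^sup>2)" for n N
  proof (cases "n = 0")
    case False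
    have "(cmod (cis (\<tau> N * ln n) - 1))\<^sup>2 \<le> 2\<^sup>2"
      using norm_triangle_ineq4[of "cis (\<tau> N * ln n)" 1] by (intro power_mono) auto
    moreover have "0 \<le> a n * (cmod (ncoef n u))\<^sup>2" using nonneg False by simp
    ultimately have "(a n * (cmod (ncoef n u))\<^sup>2) * (cmod (cis (\<tau> N * ln n) - 1))\<^sup>2 \<le>
        (a n * (cmod (ncoef n u))\<^sup>2) * 2\<^sup>2"
      by (rule mult_left_mono)
    thus ?thesis using nonneg[of n] False
      by (simp add: E_def norm_mult power_mult_distrib abs_mult mult_ac)
  qed (simp add: E_def)
  have "(\<lambda>N. \<Sum>n. E n N) \<longlonglongrightarrow> (\<Sum>n. a n * (cmod (ncoef n u * (1 - 1)))\<^sup>2)"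
    by (rule tendsto_suminf_dominated[OF E_lim E_bound])
      (intro summable_mult sums_summable[OF hnorm_k_sums[OF u]])
  from tendsto_real_sqrt[OF this] show ?thesis by (simp add: hn)
qed

text \<open>Ensures that the limit of the images under \<open>T\<close> in
  \<open>not_closable\<close> is a nonzero vector.\<close>

lemma k_nonzero:
  assumes u: "\<rho> < Re u" and supp: "seq_supp a \<noteq> {}"
  shows "k u \<noteq> (\<lambda>s. 0)"
proof
  assume "k u = (\<lambda>s. 0)"
  hence sums: "(\<lambda>n. a n * (cmod (ncoef n u))\<^sup>2) sums 0" using hnorm_k_sums[OF u] by simp
  obtain n where n: "1 \<le> n" "a n \<noteq> 0" using supp by (auto simp: seq_supp_def)
  have "a n * (cmod (ncoef n u))\<^sup>2 = 0"
    using sums weight_nonneg[of _ u 1] suminf_eq_zero_iff[of "\<lambda>n. a n * (cmod (ncoef n u))\<^sup>2"]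
    by (simp add: sums_iff del: mult_eq_0_iff)
  thus False using n ncoef_nonzero by simp
qed

end

subsection \<open>The span of the kernels on a vertical line\<close>

text \<open>Gives access to the algebraic theory of spans, independence and linear extension, used
  to construct the operator.\<close>

interpretation cfun: vector_space "\<lambda>(c::complex) (f::complex \<Rightarrow> complex) s. c * f s"
  by unfold_locales (auto simp: fun_eq_iff algebra_simps)

interpretation cfun: vector_space_pair
  "\<lambda>(c::complex) (f::complex \<Rightarrow> complex) s. c * f s" "\<lambda>(c::complex) (f::complex \<Rightarrow> complex) s. c * f s"
  by unfold_locales

lemma sum_fun_eq: "(\<Sum>i\<in>I. f i) = (\<lambda>s. \<Sum>i\<in>I. (f i s :: complex))"
  by (induction I rule: infinite_finite_induct) (auto simp: fun_eq_iff)

lemma cspan_eq_span: "cspan S = cfun.span S"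
  unfolding cspan_def cfun.span_explicit sum_fun_eq by blast

lemma cspan_add: "f \<in> cspan S \<Longrightarrow> g \<in> cspan S \<Longrightarrow> (\<lambda>s. f s + g s) \<in> cspan S"
  using cfun.span_add[of f S g] by (simp add: cspan_eq_span plus_fun_def)

lemma cspan_scale: "f \<in> cspan S \<Longrightarrow> (\<lambda>s. c * f s) \<in> cspan S"
  using cfun.span_scale[of f S c] by (simp add: cspan_eq_span)

lemma cspan_sum:
  "(\<And>i. i \<in> I \<Longrightarrow> f i \<in> S) \<Longrightarrow> (\<lambda>s. \<Sum>i\<in>I. c i * f i s) \<in> cspan S"
  unfolding cspan_eq_span
  using cfun.span_sum[of I "\<lambda>i s. c i * f i s" S] cfun.span_scale[OF cfun.span_base]
  by (simp add: sum_fun_eq)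

locale dirichlet_rkhs_line = dirichlet_rkhs +
  fixes \<alpha> :: real
  assumes \<alpha>: "\<rho> < \<alpha>"
begin

definition L :: "real \<Rightarrow> complex" where "L b = of_real \<alpha> + \<i> * of_real b"

definition D :: "(complex \<Rightarrow> complex) set" where "D = cspan (range (\<lambda>b. k (L b)))"

lemma Re_L [simp]: "\<rho> < Re (L b)"
  using \<alpha> by (simp add: L_def)

lemma L_shift: "L b + \<i> * of_real c = L (b + c)"
  by (simp add: L_def algebra_simps)

lemma ncoef_L: "ncoef n (L b) = ncoef n (of_real \<alpha>) * cis (b * ln n)"
  by (simp add: L_def ncoef_vertical_shift)

lemma kL_mem [simp]: "k (L b) \<in> H"
  by (simp add: k_mem)

lemma D_sum: "(\<lambda>s. \<Sum>b\<in>B. c b * k (L (h b)) s) \<in> D"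
  unfolding D_def by (intro cspan_sum) auto

lemma D_zero: "(\<lambda>s. 0) \<in> D"
  using D_sum[of _ _ "{}"] by simp

lemma D_base: "k (L b) \<in> D"
  using D_sum[of "\<lambda>_. 1" "\<lambda>_. b" "{()}"] by simp

lemma D_add: "f \<in> D \<Longrightarrow> g \<in> D \<Longrightarrow> (\<lambda>s. f s + g s) \<in> D"
  unfolding D_def by (rule cspan_add)

lemma D_scale: "f \<in> D \<Longrightarrow> (\<lambda>s. c * f s) \<in> D"
  unfolding D_def by (rule cspan_scale)

lemma D_diff: "f \<in> D \<Longrightarrow> g \<in> D \<Longrightarrow> (\<lambda>s. f s - g s) \<in> D"
  using D_add[OF _ D_scale[of g "-1"], of f] by simp

text \<open>The heights \<open>B\<close> are chosen as a preimage on which the parametrization is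
  injective, so the sum can be reindexed before the kernels are known to be distinct.\<close>

lemma D_cases:
  assumes "f \<in> D"
  obtains B c where "finite B" "f = (\<lambda>s. \<Sum>b\<in>B. c b * k (L b) s)"
proof -
  obtain F c where F: "finite F" "F \<subseteq> range (\<lambda>b. k (L b))" "f = (\<lambda>s. \<Sum>g\<in>F. c g * g s)"
    using assms by (auto simp: D_def cspan_def)
  obtain B where B: "inj_on (\<lambda>b. k (L b)) B" "F = (\<lambda>b. k (L b)) ` B"
    using F(2) by (auto simp: subset_image_inj)
  have "finite B" using F(1) B by (simp add: finite_image_iff)
  show ?thesis
    by (rule that[OF \<open>finite B\<close>, of "\<lambda>b. c (k (L b))"])
      (simp add: F(3) B(2) sum.reindex[OF B(1)])
qed

lemma D_subset: "D \<subseteq> H"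
  by (auto elim!: D_cases intro!: sum_mem)

lemma D_dense: "dense_in H ip D"
proof (rule dense_if_orthogonal_trivial[OF D_subset D_zero D_add D_scale])
  fix g assume g: "g \<in> H" "\<And>d. d \<in> D \<Longrightarrow> ip g d = 0"
  show "g = (\<lambda>s. 0)"
    by (rule zero_on_line_imp_zero[OF g(1) \<alpha>])
      (use g(2)[OF D_base] reproducing[OF g(1) Re_L] in \<open>simp add: L_def\<close>)
qed

text \<open>A combination of norm 0 has all its weighted squares equal to 0. On the support the
  weight and the common factor \<open>ncoef n (of_real \<alpha>)\<close> are nonzero, which leaves a
  relation between characters.\<close>

lemma kernels_independent:
  assumes adm: "admissible a" and B: "finite B"
    and zero: "(\<lambda>s. \<Sum>b\<in>B. c b * k (L b) s) = (\<lambda>s. 0)" and b: "b \<in> B"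
  shows "c b = 0"
proof -
  obtain p q where pq: "p \<in> seq_supp a" "q \<in> seq_supp a" "p \<noteq> 1" "q \<noteq> 1" "coprime p q"
    using adm by (auto simp: admissible_def)
  have pq1: "1 < p" "1 < q" using pq by (auto simp: seq_supp_def)
  have factor: "(\<Sum>b\<in>B. c b * ncoef n (L b)) = ncoef n (of_real \<alpha>) * (\<Sum>b\<in>B. c b * cis (b * ln n))" for n
    by (simp add: ncoef_L sum_distrib_left mult_ac)
  have "(\<lambda>n. a n * (cmod (\<Sum>b\<in>B. c b * ncoef n (L b)))\<^sup>2) sums 0"
    using hnorm_combination_sums[of B L c] zero by simp
  hence zero': "\<forall>n. a n * (cmod (\<Sum>b\<in>B. c b * ncoef n (L b)))\<^sup>2 = 0"
    using weight_nonneg suminf_eq_zero_iff[of "\<lambda>n. a n * (cmod (\<Sum>b\<in>B. c b * ncoef n (L b)))\<^sup>2"]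
    unfolding factor by (simp add: sums_iff del: mult_eq_0_iff)
  have rel: "(\<Sum>b\<in>B. c b * cis (b * ln (real n))) = 0" if "n \<in> seq_supp a" for n
    using zero'[rule_format, of n] that ncoef_nonzero[of n]
    unfolding factor by (simp add: seq_supp_def norm_mult)
  have closed: "m * n \<in> seq_supp a" if "m \<in> seq_supp a" "n \<in> seq_supp a" for m n
    using adm that unfolding admissible_def by blast
  show ?thesis
    by (rule characters_independent[OF closed pq(1,2) pq1 pq(5) _ B rel b])
      (simp_all add: seq_supp_def)
qed

lemma kernels_inj:
  assumes adm: "admissible a" shows "inj (\<lambda>b. k (L b))"
proof (rule injI, rule ccontr)
  fix x y assume "k (L x) = k (L y)" "x \<noteq> y"
  hence "(\<lambda>s. \<Sum>b\<in>{x, y}. (if b = x then 1 else -1) * k (L b) s) = (\<lambda>s. 0)" by simp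
  from kernels_independent[OF adm _ this, of x] show False by simp
qed

lemma exists_operator:
  assumes adm: "admissible a"
  shows "\<exists>T. linear_op_on H D T \<and> (\<forall>b. T (k (L b)) = (\<lambda>s. \<i> * of_real b * k (L b) s))"
proof -
  have indep: "cfun.independent (range (\<lambda>b. k (L b)))"
    unfolding cfun.independent_explicit_finite_subsets
  proof (intro allI impI ballI)
    fix F u v
    assume F: "F \<subseteq> range (\<lambda>b. k (L b))" "finite F" "(\<Sum>v\<in>F. (\<lambda>s. u v * v s)) = 0" "v \<in> F"
    obtain B where B: "inj_on (\<lambda>b. k (L b)) B" "F = (\<lambda>b. k (L b)) ` B"
      using F(1) by (auto simp: subset_image_inj)
    have "finite B" using F(2) B by (simp add: finite_image_iff)
    have "(\<lambda>s. \<Sum>b\<in>B. u (k (L b)) * k (L b) s) = (\<lambda>s. 0)"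
      using F(3) by (simp add: sum_fun_eq zero_fun_def B(2) sum.reindex[OF B(1)])
    thus "u v = 0" using kernels_independent[OF adm \<open>finite B\<close>] F(4) B(2) by auto
  qed
  \<comment> \<open>The eigenvalue is read off from the kernel: by \<open>kernels_inj\<close> the
    inverse of the parametrization recovers the height \<open>b\<close>.\<close>
  define F where "F g = (\<lambda>s. \<i> * of_real (inv (\<lambda>b. k (L b)) g) * g s)" for g :: "complex \<Rightarrow> complex"
  obtain T where T: "Vector_Spaces.linear (\<lambda>c f s. c * f s) (\<lambda>c f s. c * f s) T"
      "\<And>b. T (k (L b)) = F (k (L b))"
    using cfun.linear_independent_extend[OF indep, of F] by auto
  interpret T: Vector_Spaces.linear "\<lambda>(c::complex) (f::complex \<Rightarrow> complex) s. c * f s"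
    "\<lambda>(c::complex) (f::complex \<Rightarrow> complex) s. c * f s" T by (rule T(1))
  have TL: "T (k (L b)) = (\<lambda>s. \<i> * of_real b * k (L b) s)" for b
    by (simp add: T(2) F_def inv_f_f[OF kernels_inj[OF adm]])
  have Tadd: "T (\<lambda>s. f s + g s) = (\<lambda>s. T f s + T g s)" for f g
    using T.add[of f g] by (simp add: plus_fun_def)
  have Tscale: "T (\<lambda>s. c * f s) = (\<lambda>s. c * T f s)" for c f
    by (rule T.scale)
  have "T f \<in> H" if "f \<in> D" for f
  proof -
    obtain B c where "finite B" and f: "f = (\<lambda>s. \<Sum>b\<in>B. c b * k (L b) s)" using D_cases[OF \<open>f \<in> D\<close>] by blast
    have "T f = (\<lambda>s. \<Sum>b\<in>B. c b * T (k (L b)) s)"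
      using T.sum[of "\<lambda>b s. c b * k (L b) s" B] by (simp add: f sum_fun_eq Tscale)
    thus ?thesis by (simp add: sum_mem TL)
  qed
  hence "linear_op_on H D T"
    by (simp add: linear_op_on_def D_subset D_zero D_add D_scale Tadd Tscale)
  thus ?thesis using TL by blast
qed

subsection \<open>Vertical translations\<close>

text \<open>Defined pointwise on all functions rather than as a continuous extension from
  \<open>D\<close>: linearity and the inverse \<open>V (- c)\<close> are then immediate, but
  membership in \<open>H\<close> must be proved.\<close>

definition V :: "real \<Rightarrow> (complex \<Rightarrow> complex) \<Rightarrow> complex \<Rightarrow> complex" where
  "V c f = (\<lambda>s. f (s - \<i> * of_real c))"

lemma V_k: "V c (k u) = k (u + \<i> * of_real c)"
proof
  fix s
  have "s - \<i> * of_real c + cnj u = s + cnj (u + \<i> * of_real c)" by simp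
  thus "V c (k u) s = k (u + \<i> * of_real c) s"
    unfolding V_def kfun_def dkernel_def by (simp only:) simp
qed

lemma V_sum: "V c (\<lambda>s. \<Sum>b\<in>B. d b * k (L b) s) = (\<lambda>s. \<Sum>b\<in>B. d b * k (L (b + c)) s)"
proof -
  have "k (L b) (s - \<i> * of_real c) = k (L (b + c)) s" for b s
    using fun_cong[OF V_k[of c "L b"], of s] by (simp add: V_def L_shift)
  thus ?thesis by (simp add: V_def)
qed

lemma V_D: "f \<in> D \<Longrightarrow> V c f \<in> D"
  by (elim D_cases) (simp add: V_sum D_sum)

text \<open>Translation multiplies the \<open>n\<close>-th entry of the whole combination by
  \<open>cis (c * ln n)\<close>, of modulus 1.\<close>

lemma hnorm_V_D:
  assumes "f \<in> D" shows "hnorm ip (V c f) = hnorm ip f"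
proof -
  obtain B d where f: "f = (\<lambda>s. \<Sum>b\<in>B. d b * k (L b) s)" using D_cases[OF assms] by blast
  have "(\<Sum>b\<in>B. d b * ncoef n (L (b + c))) = (\<Sum>b\<in>B. d b * ncoef n (L b)) * cis (c * ln n)" for n
    unfolding sum_distrib_right by (simp add: ncoef_vertical_shift mult.assoc flip: L_shift)
  hence "cmod (\<Sum>b\<in>B. d b * ncoef n (L (b + c))) = cmod (\<Sum>b\<in>B. d b * ncoef n (L b))" for n
    by (simp add: norm_mult)
  hence "(\<lambda>n. a n * (cmod (\<Sum>b\<in>B. d b * ncoef n (L b)))\<^sup>2) sums (hnorm ip (V c f))\<^sup>2"
    using hnorm_combination_sums[of B "\<lambda>b. L (b + c)" d] by (simp add: f V_sum)
  moreover have "(\<lambda>n. a n * (cmod (\<Sum>b\<in>B. d b * ncoef n (L b)))\<^sup>2) sums (hnorm ip f)\<^sup>2"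
    using hnorm_combination_sums[of B L d] by (simp add: f)
  ultimately have "(hnorm ip (V c f))\<^sup>2 = (hnorm ip f)\<^sup>2" by (rule sums_unique2)
  moreover have "f \<in> H" "V c f \<in> H" using assms V_D D_subset by blast+
  ultimately show ?thesis by (simp add: power2_eq_iff_nonneg)
qed

text \<open>Translates of approximants from \<open>D\<close> form a Cauchy sequence by
  \<open>hnorm_V_D\<close>. Point evaluations are continuous, so its limit in \<open>H\<close> must
  be the pointwise translate \<open>V c f\<close>.\<close>

lemma V_isometry:
  assumes f: "f \<in> H" shows "V c f \<in> H \<and> hnorm ip (V c f) = hnorm ip f"
proof -
  have "\<exists>g\<in>D. hnorm ip (\<lambda>s. f s - g s) < inverse (real (Suc n))" for n
    using D_dense f unfolding dense_in_def by (meson inverse_positive_iff_positive of_nat_0_less_iff zero_less_Suc)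
  then obtain g where gD: "\<And>n. g n \<in> D"
    and g: "\<And>n. hnorm ip (\<lambda>s. f s - g n s) < inverse (real (Suc n))" by metis
  have gH: "g n \<in> H" and VgH: "V c (g n) \<in> H" for n using gD D_subset V_D by blast+
  have lim_g: "(\<lambda>n. hnorm ip (\<lambda>s. g n s - f s)) \<longlonglongrightarrow> 0"
  proof (rule tendsto_sandwich[OF _ _ tendsto_const LIMSEQ_inverse_real_of_nat])
    show "\<forall>\<^sub>F n in sequentially. hnorm ip (\<lambda>s. g n s - f s) \<le> inverse (real (Suc n))"
      using g by (simp add: hnorm_minus_commute[OF gH f] less_imp_le)
  qed (simp add: gH f)
  have Vdiff: "hnorm ip (\<lambda>s. V c (g m) s - V c (g n) s) = hnorm ip (\<lambda>s. g m s - g n s)" for m n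
    using hnorm_V_D[OF D_diff[OF gD gD], of c m n] by (simp add: V_def)
  have cauchy: "\<exists>N. \<forall>m\<ge>N. \<forall>n\<ge>N. hnorm ip (\<lambda>s. V c (g m) s - V c (g n) s) < e" if e: "0 < e" for e
  proof -
    obtain N where N: "\<And>n. n \<ge> N \<Longrightarrow> hnorm ip (\<lambda>s. g n s - f s) < e / 2"
      using order_tendstoD(2)[OF lim_g, of "e / 2"] e by (auto simp: eventually_sequentially)
    have "hnorm ip (\<lambda>s. g m s - g n s) < e" if "m \<ge> N" "n \<ge> N" for m n
      using hnorm_diff_triangle[OF gH[of m] f gH[of n]] N[OF that(1)] N[OF that(2)]
        hnorm_minus_commute[OF f gH[of n]] by simp
    thus ?thesis by (auto simp: Vdiff)
  qed
  obtain h where h: "h \<in> H" and lim_h: "(\<lambda>n. hnorm ip (\<lambda>s. V c (g n) s - h s)) \<longlonglongrightarrow> 0"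
    using complete[OF VgH cauchy] by blast
  have "h s = V c f s" for s
  proof (cases "\<rho> < Re s")
    case True
    have "(\<lambda>n. V c (g n) s) \<longlonglongrightarrow> V c f s"
      unfolding V_def by (rule tendsto_eval[OF gH f lim_g]) (use True in simp)
    thus ?thesis using tendsto_eval[OF VgH h lim_h True] LIMSEQ_unique by blast
  next
    case False
    thus ?thesis using vanishing[OF h, of s] vanishing[OF f, of "s - \<i> * of_real c"] by (simp add: V_def)
  qed
  hence hV: "h = V c f" by blast
  have "(\<lambda>n. hnorm ip (g n)) \<longlonglongrightarrow> hnorm ip h"
    using tendsto_hnorm[OF VgH h lim_h] by (simp add: hnorm_V_D[OF gD])
  hence "hnorm ip h = hnorm ip f"
    using tendsto_hnorm[OF gH f lim_g] LIMSEQ_unique by blast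
  thus ?thesis using h hV by simp
qed

lemma V_unitary: "unitary_on H ip (V c)"
  unfolding unitary_on_def
proof (intro conjI ballI)
  have "V c (V (- c) f) = f" for f by (simp add: V_def)
  thus "V c ` H = H" using V_isometry by (metis (no_types, lifting) image_iff subsetI subset_antisym)
  fix f g assume fg: "f \<in> H" "g \<in> H"
  have "hnorm ip (\<lambda>s. V c f s + z * V c g s) = hnorm ip (\<lambda>s. f s + z * g s)" for z
    using V_isometry[of "\<lambda>s. f s + z * g s" c] fg by (simp add: V_def)
  from this[of 1] this[of "-1"] this[of \<i>] this[of "-\<i>"]
  have "4 * ip (V c f) (V c g) = 4 * ip f g"
    using fg V_isometry by (simp add: ip_polarization)
  thus "ip (V c f) (V c g) = ip f g" by simp
qed

subsection \<open>The operator\<close>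

context
  fixes T :: "(complex \<Rightarrow> complex) \<Rightarrow> complex \<Rightarrow> complex"
  assumes T_linear: "linear_op_on H D T"
    and T_k: "\<And>b. T (k (L b)) = (\<lambda>s. \<i> * of_real b * k (L b) s)"
begin

lemma T_mem: "f \<in> D \<Longrightarrow> T f \<in> H"
  and T_add: "f \<in> D \<Longrightarrow> g \<in> D \<Longrightarrow> T (\<lambda>s. f s + g s) = (\<lambda>s. T f s + T g s)"
  and T_scale: "f \<in> D \<Longrightarrow> T (\<lambda>s. c * f s) = (\<lambda>s. c * T f s)"
  using T_linear unfolding linear_op_on_def by blast+

text \<open>The heights \<open>h b\<close> may repeat, which covers translated sums as well as
  differences of two kernels.\<close>

lemma T_sum: "finite B \<Longrightarrow> T (\<lambda>s. \<Sum>b\<in>B. d b * k (L (h b)) s) =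
    (\<lambda>s. \<Sum>b\<in>B. d b * (\<i> * of_real (h b) * k (L (h b)) s))"
proof (induction B rule: finite_induct)
  case empty
  show ?case using T_scale[OF D_zero, of 0] by simp
next
  case (insert b B)
  have "T (\<lambda>s. d b * k (L (h b)) s + (\<Sum>b\<in>B. d b * k (L (h b)) s)) =
      (\<lambda>s. d b * (\<i> * of_real (h b) * k (L (h b)) s) +
        (\<Sum>b\<in>B. d b * (\<i> * of_real (h b) * k (L (h b)) s)))"
    unfolding T_add[OF D_scale[OF D_base] D_sum] T_scale[OF D_base] T_k insert.IH ..
  thus ?case using insert.hyps by simp
qed

text \<open>Translation by \<open>c\<close> takes an eigenvector for \<open>\<i> * b\<close> to one
  for \<open>\<i> * (b + c)\<close>, and subtracting \<open>\<i> * c\<close> restores the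
  eigenvalue.\<close>

lemma T_homogeneous_line: "T_homogeneous H ip D T"
  unfolding T_homogeneous_def
proof (intro conjI allI T_linear D_dense)
  fix c :: real
  have "V c (T f) = (\<lambda>s. T (V c f) s - \<i> * of_real c * V c f s)" if "f \<in> D" for f
  proof -
    obtain B d where B: "finite B" and f: "f = (\<lambda>s. \<Sum>b\<in>B. d b * k (L b) s)"
      using D_cases[OF \<open>f \<in> D\<close>] by blast
    have "V c (T f) = V c (\<lambda>s. \<Sum>b\<in>B. (d b * (\<i> * of_real b)) * k (L b) s)"
      using T_sum[OF B, of d "\<lambda>b. b"] by (simp add: f mult_ac)
    also have "\<dots> = (\<lambda>s. \<Sum>b\<in>B. (d b * (\<i> * of_real b)) * k (L (b + c)) s)"
      by (rule V_sum)
    also have "\<dots> = (\<lambda>s. T (V c f) s - \<i> * of_real c * V c f s)"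
      using T_sum[OF B, of d "\<lambda>b. b + c"]
      by (simp add: f V_sum sum_distrib_left algebra_simps flip: sum_subtractf)
    finally show ?thesis .
  qed
  thus "\<exists>U. unitary_on H ip U \<and> U ` D \<subseteq> D \<and>
      (\<forall>f\<in>D. U (T f) = (\<lambda>s. T (U f) s - \<i> * of_real c * U f s))"
    using V_unitary V_D by blast
qed

text \<open>The difference quotients of \<open>b \<mapsto> k (L b)\<close> along recurrence times tend to \<open>0\<close>, but their
  images under \<open>T\<close> do not.\<close>

lemma difference_quotients:
  obtains x where "\<And>N::nat. x N \<in> D" "(\<lambda>N. hnorm ip (x N)) \<longlonglongrightarrow> 0"
    "(\<lambda>N. hnorm ip (\<lambda>s. T (x N) s - k (L b) s)) \<longlonglongrightarrow> 0"
proof -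
  obtain \<tau> :: "nat \<Rightarrow> real" where \<tau>: "filterlim \<tau> at_top sequentially"
    "\<And>n::nat. (\<lambda>N. cis (\<tau> N * ln n)) \<longlonglongrightarrow> 1" using exists_recurrence_times by blast
  define d where "d N = (\<lambda>s. k (L (b + \<tau> N)) s - k (L b) s)" for N
  define x where "x N = (\<lambda>s. inverse (\<i> * of_real (\<tau> N)) * d N s)" for N
  have dD: "d N \<in> D" for N unfolding d_def by (intro D_diff D_base)
  have dH: "d N \<in> H" for N using dD D_subset by blast
  have d_lim: "(\<lambda>N. hnorm ip (d N)) \<longlonglongrightarrow> 0"
    unfolding d_def using hnorm_k_recurrence[OF Re_L[of b] \<tau>(2)] by (simp add: L_shift)
  have inv_lim: "(\<lambda>N. inverse (\<tau> N)) \<longlonglongrightarrow> 0"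
    using \<tau>(1) by (rule tendsto_inverse_0_at_top)
  have x_norm: "hnorm ip (x N) = \<bar>inverse (\<tau> N)\<bar> * hnorm ip (d N)" for N
    unfolding x_def hnorm_scale[OF dH] by (simp add: norm_inverse norm_mult)
  have x_lim: "(\<lambda>N. hnorm ip (x N)) \<longlonglongrightarrow> 0"
    unfolding x_norm using tendsto_mult[OF tendsto_rabs[OF inv_lim] d_lim] by simp
  \<comment> \<open>The eigenvalue at height \<open>b + \<tau> N\<close> is split. Divided by
    \<open>\<i> * \<tau> N\<close>, the first summand becomes the kernel at that height, which tends
    to \<open>k (L b)\<close>, and the second becomes \<open>\<i> * b * x N\<close>, which tends to
    0.\<close>
  have Td: "T (d N) = (\<lambda>s. \<i> * of_real (\<tau> N) * k (L (b + \<tau> N)) s + \<i> * of_real b * d N s)" for N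
    using T_sum[of "{True, False}" "\<lambda>j. if j then 1 else -1" "\<lambda>j. if j then b + \<tau> N else b"]
    by (simp add: d_def algebra_simps)
  have "hnorm ip (\<lambda>s. T (x N) s - k (L b) s) \<le> hnorm ip (d N) + \<bar>b\<bar> * hnorm ip (x N)"
    if "0 < \<tau> N" for N
  proof -
    have "T (x N) = (\<lambda>s. inverse (\<i> * of_real (\<tau> N)) *
        (\<i> * of_real (\<tau> N) * k (L (b + \<tau> N)) s + \<i> * of_real b * d N s))"
      unfolding x_def T_scale[OF dD] Td ..
    also have "\<dots> = (\<lambda>s. k (L (b + \<tau> N)) s + (\<i> * of_real b) * x N s)"
    proof -
      have cancel: "inverse z * (z * p + y * w) = p + y * (inverse z * w)" if "z \<noteq> 0" for z p y w :: complex
        using that by (simp add: field_simps)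
      have "\<i> * complex_of_real (\<tau> N) \<noteq> 0" using \<open>0 < \<tau> N\<close> by simp
      thus ?thesis unfolding x_def by (simp only: cancel not_False_eq_True)
    qed
    finally have "(\<lambda>s. T (x N) s - k (L b) s) = (\<lambda>s. d N s + (\<i> * of_real b) * x N s)"
      by (simp add: d_def algebra_simps)
    moreover have "x N \<in> H" unfolding x_def by (rule scale_mem[OF dH])
    ultimately show ?thesis
      using hnorm_triangle[OF dH scale_mem[of "x N" "\<i> * of_real b"], of N]
        hnorm_scale[of "x N" "\<i> * of_real b"] by (simp add: norm_mult)
  qed
  hence bound: "\<forall>\<^sub>F N in sequentially. hnorm ip (\<lambda>s. T (x N) s - k (L b) s) \<le>
      hnorm ip (d N) + \<bar>b\<bar> * hnorm ip (x N)"
    using \<tau>(1) by (auto simp: filterlim_at_top_dense elim!: allE[of _ 0] eventually_mono)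
  have xD: "x N \<in> D" for N unfolding x_def by (intro D_scale dD)
  have "T (x N) \<in> H" for N by (rule T_mem[OF xD])
  hence "\<forall>\<^sub>F N in sequentially. 0 \<le> hnorm ip (\<lambda>s. T (x N) s - k (L b) s)" by simp
  moreover have "(\<lambda>N. hnorm ip (d N) + \<bar>b\<bar> * hnorm ip (x N)) \<longlonglongrightarrow> 0 + \<bar>b\<bar> * 0"
    by (intro tendsto_intros d_lim x_lim)
  ultimately have "(\<lambda>N. hnorm ip (\<lambda>s. T (x N) s - k (L b) s)) \<longlonglongrightarrow> 0"
    using tendsto_sandwich[OF _ bound tendsto_const] by simp
  thus ?thesis using that xD x_lim by blast
qed

text \<open>Along the difference quotients the relation \<open>ip (T x) g = ip x h\<close> passes to
  the limit \<open>ip (k (L b)) g = 0\<close>. So \<open>g\<close> vanishes on the line, and hence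
  everywhere.\<close>

lemma adjoint_domain_trivial: "adjoint_domain H ip D T = {\<lambda>s. 0}"
proof (intro equalityI subsetI)
  fix g assume "g \<in> adjoint_domain H ip D T"
  then obtain h where g: "g \<in> H" and h: "h \<in> H" and adj: "\<And>f. f \<in> D \<Longrightarrow> ip (T f) g = ip f h"
    by (auto simp: adjoint_domain_def)
  have "g (L b) = 0" for b
  proof -
    obtain x where x: "\<And>N::nat. x N \<in> D" "(\<lambda>N. hnorm ip (x N)) \<longlonglongrightarrow> 0"
      "(\<lambda>N. hnorm ip (\<lambda>s. T (x N) s - k (L b) s)) \<longlonglongrightarrow> 0" using difference_quotients by metis
    have xH: "x N \<in> H" for N using x(1) D_subset by blast
    have TxH: "T (x N) \<in> H" for N by (rule T_mem[OF x(1)])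
    have "(\<lambda>N. ip (T (x N)) g) \<longlonglongrightarrow> ip (k (L b)) g"
      by (rule tendsto_ip_left[OF TxH kL_mem g x(3)])
    moreover have "(\<lambda>N. ip (T (x N)) g) \<longlonglongrightarrow> 0"
      using tendsto_ip_left[OF xH zero_mem h] x(2) by (simp add: adj[OF x(1)] h)
    ultimately have "ip (k (L b)) g = 0" using LIMSEQ_unique by blast
    thus ?thesis using reproducing[OF g Re_L, of b] ip_commute[OF kL_mem g, of b] by simp
  qed
  thus "g \<in> {\<lambda>s. 0}" using zero_on_line_imp_zero[OF g \<alpha>] by (simp add: L_def)
next
  fix g :: "complex \<Rightarrow> complex" assume "g \<in> {\<lambda>s. 0}"
  hence g0: "g = (\<lambda>s. 0)" by simp
  have "ip (T f) g = ip f (\<lambda>s. 0)" if "f \<in> D" for f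
    unfolding g0 using T_mem[OF that] D_subset that by (simp add: subset_iff)
  moreover have "g \<in> H" by (simp add: g0)
  ultimately show "g \<in> adjoint_domain H ip D T"
    unfolding adjoint_domain_def using zero_mem by blast
qed

lemma not_closable:
  assumes "seq_supp a \<noteq> {}" shows "\<not> closable H ip D T"
proof
  assume cl: "closable H ip D T"
  obtain x where "\<And>N::nat. x N \<in> D" "(\<lambda>N. hnorm ip (x N)) \<longlonglongrightarrow> 0"
    "(\<lambda>N. hnorm ip (\<lambda>s. T (x N) s - k (L 0) s)) \<longlonglongrightarrow> 0" using difference_quotients[of 0] by blast
  hence "k (L 0) = (\<lambda>s. 0)" using cl[unfolded closable_def, rule_format, of x "k (L 0)"] kL_mem[of 0] by blast
  thus False using k_nonzero[OF Re_L assms] by blast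
qed

end

end

theorem theorem5p4:
  fixes \<rho> \<alpha> :: real and a :: "nat \<Rightarrow> real"
    and H :: "(complex \<Rightarrow> complex) set"
    and ip :: "(complex \<Rightarrow> complex) \<Rightarrow> (complex \<Rightarrow> complex) \<Rightarrow> complex"
  assumes adm: "admissible a"
    and nonneg: "\<forall>n\<ge>1. 0 \<le> a n"
    and conv: "\<forall>s u. \<rho> < Re s \<longrightarrow> \<rho> < Re u \<longrightarrow>
                 summable (\<lambda>n. complex_of_real (a n) * of_nat n powr (- (s + cnj u)))"
    and rkhs: "is_rkhs \<rho> (dkernel a) H ip"
    and alpha: "\<rho> < \<alpha>"
  shows "(\<exists>T. linear_op_on H (cspan {kfun \<rho> a (of_real \<alpha> + \<i> * of_real b) | b. True}) T \<and>
              (\<forall>b::real. T (kfun \<rho> a (of_real \<alpha> + \<i> * of_real b)) =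
                 (\<lambda>s. \<i> * of_real b * kfun \<rho> a (of_real \<alpha> + \<i> * of_real b) s)))
       \<and> (\<forall>T. linear_op_on H (cspan {kfun \<rho> a (of_real \<alpha> + \<i> * of_real b) | b. True}) T \<and>
              (\<forall>b::real. T (kfun \<rho> a (of_real \<alpha> + \<i> * of_real b)) =
                 (\<lambda>s. \<i> * of_real b * kfun \<rho> a (of_real \<alpha> + \<i> * of_real b) s))
            \<longrightarrow> T_homogeneous H ip (cspan {kfun \<rho> a (of_real \<alpha> + \<i> * of_real b) | b. True}) T
              \<and> adjoint_domain H ip (cspan {kfun \<rho> a (of_real \<alpha> + \<i> * of_real b) | b. True}) T
                  = {\<lambda>s. 0}
              \<and> \<not> closable H ip (cspan {kfun \<rho> a (of_real \<alpha> + \<i> * of_real b) | b. True}) T)"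
proof -
  interpret dirichlet_rkhs_line \<rho> a H ip \<alpha>
    by unfold_locales (use nonneg conv rkhs alpha in auto)
  have D: "cspan {kfun \<rho> a (L b) | b. True} = D"
    by (simp add: D_def full_SetCompr_eq)
  have "seq_supp a \<noteq> {}" using adm by (auto simp: admissible_def)
  hence "T_homogeneous H ip D T \<and> adjoint_domain H ip D T = {\<lambda>s. 0} \<and> \<not> closable H ip D T"
    if "linear_op_on H D T \<and> (\<forall>b. T (kfun \<rho> a (L b)) = (\<lambda>s. \<i> * of_real b * kfun \<rho> a (L b) s))"
    for T
    using that T_homogeneous_line[of T] adjoint_domain_trivial[of T] not_closable[of T] by simp
  thus ?thesis
    unfolding L_def[symmetric] D using exists_operator[OF adm] by blast
qed

end
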